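(* Let $a,b$ be nonnegative integers. If $r,s$ are integers relatively prime to $2$ with $r>0$, then \[a_0^{(10)}(2^ar,2^bs)\equiv 0 \pmod{2^{a-b+1}}\ \text{ if } a>b,\qquad a_0^{(10)}(2^ar,2^bs)\equiv 0 \pmod{2}\ \text{ if } b>a.\] If $r,s$ are integers relatively prime to $5$ with $r>0$, then \[a_0^{(10)}(5^ar,5^bs)\equiv 0 \pmod{5^{a-b}}\ \text{ if } a>b.\]
   Context: $M_0^\sharp(10)$ is the space of weakly holomorphic modular functions (weight $0$) for $\Gamma_0(10)$ that are holomorphic on the upper half plane and at all cusps other than $\infty$. Write $q=e^{2\pi i z}$. For each integer $m\ge 0$, $f_{0,m}^{(10)}$ is the unique element of $M_0^\sharp(10)$ with Fourier expansion $q^{-m}+\sum_{n\ge 1}a_0^{(10)}(m,n)q^n$ (with $f_{0,0}^{(10)}=1$). For any integer $n$, $a_0^{(10)}(m,n)$ denotes the coefficient of $q^n$ in $f_{0,m}^{(10)}$; these are integers. *)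

theory Defs
  imports
    "HOL-Complex_Analysis.Complex_Analysis"
    "HOL-Library.FuncSet"
    "HOL-Number_Theory.Cong"
begin

definition upper_half_plane :: "complex set" where
  "upper_half_plane = {z. Im z > 0}"

definition SL2Z :: "(int^2^2) set" where
  "SL2Z = {A. det A = 1}"

definition Gamma0 :: "nat \<Rightarrow> (int^2^2) set" where
  "Gamma0 N = {A \<in> SL2Z. int N dvd A $ 2 $ 1}"

definition moebius :: "int^2^2 \<Rightarrow> complex \<Rightarrow> complex" where
  "moebius A z = (of_int (A $ 1 $ 1) * z + of_int (A $ 1 $ 2)) /
                 (of_int (A $ 2 $ 1) * z + of_int (A $ 2 $ 2))"

text \<open>
  Every cusp is of the form \<open>A \<infinity> = A\<^sub>1\<^sub>1 / A\<^sub>2\<^sub>1\<close> with \<open>A\<close> in \<^const>\<open>SL2Z\<close>. The following says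
  that it represents the cusp \<open>\<infinity>\<close> of \<open>\<Gamma>\<^sub>0(N)\<close>, i.e. \<open>A \<infinity> = B \<infinity>\<close> for some \<open>B\<close> in \<open>\<Gamma>\<^sub>0(N)\<close>;
  equality of the two points of the projective line is written by cross-multiplication.
\<close>
definition is_cusp_infinity :: "nat \<Rightarrow> int^2^2 \<Rightarrow> bool" where
  "is_cusp_infinity N A \<longleftrightarrow>
     (\<exists>B\<in>Gamma0 N. A $ 1 $ 1 * B $ 2 $ 1 = B $ 1 $ 1 * A $ 2 $ 1)"

text \<open>
  \<open>F\<close> is the expansion of \<open>f\<close> in powers of \<open>exp (2 \<pi> i z / h)\<close>. Since \<open>F\<close> is a formal Laurent
  series, it has only finitely many terms with negative exponent.
\<close>
definition has_q_expansion :: "nat \<Rightarrow> (complex \<Rightarrow> complex) \<Rightarrow> complex fls \<Rightarrow> bool" where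
  "has_q_expansion h f F \<longleftrightarrow>
     (\<exists>g. g has_laurent_expansion F \<and>
          (\<forall>z\<in>upper_half_plane. f z = g (exp (2 * of_real pi * \<i> * z / of_nat h))))"

definition meromorphic_at_cusp :: "int^2^2 \<Rightarrow> (complex \<Rightarrow> complex) \<Rightarrow> bool" where
  "meromorphic_at_cusp A f \<longleftrightarrow>
     (\<exists>h>0. \<exists>F. has_q_expansion h (\<lambda>z. f (moebius A z)) F)"

definition holomorphic_at_cusp :: "int^2^2 \<Rightarrow> (complex \<Rightarrow> complex) \<Rightarrow> bool" where
  "holomorphic_at_cusp A f \<longleftrightarrow>
     (\<exists>h>0. \<exists>F. has_q_expansion h (\<lambda>z. f (moebius A z)) F \<and> (\<forall>n<0. fls_nth F n = 0))"

text \<open>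
  Weakly holomorphic modular functions (weight \<open>0\<close>). A function on the upper half plane is
  represented by a total function with the fixed value \<^term>\<open>undefined\<close> elsewhere, so that
  uniqueness of such a function makes sense.
\<close>
definition weakly_holomorphic_modular_functions :: "nat \<Rightarrow> (complex \<Rightarrow> complex) set" where
  "weakly_holomorphic_modular_functions N =
     {f \<in> extensional upper_half_plane.
        f holomorphic_on upper_half_plane \<and>
        (\<forall>A\<in>Gamma0 N. \<forall>z\<in>upper_half_plane. f (moebius A z) = f z) \<and>
        (\<forall>A\<in>SL2Z. meromorphic_at_cusp A f)}"

definition M0_sharp :: "nat \<Rightarrow> (complex \<Rightarrow> complex) set" where
  "M0_sharp N =
     {f \<in> weakly_holomorphic_modular_functions N.
        \<forall>A\<in>SL2Z. \<not> is_cusp_infinity N A \<longrightarrow> holomorphic_at_cusp A f}"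

definition f0 :: "nat \<Rightarrow> nat \<Rightarrow> complex \<Rightarrow> complex" where
  "f0 N m = (THE f. f \<in> M0_sharp N \<and>
     (\<exists>F. has_q_expansion 1 f F \<and>
          (\<forall>n\<le>0. fls_nth F n = (if n = - int m then 1 else 0))))"

definition q_expansion :: "(complex \<Rightarrow> complex) \<Rightarrow> complex fls" where
  "q_expansion f = (THE F. has_q_expansion 1 f F)"

definition a0 :: "nat \<Rightarrow> nat \<Rightarrow> int \<Rightarrow> complex" where
  "a0 N m n = fls_nth (q_expansion (f0 N m)) n"

text \<open>
  Congruence for a complex number; integrality of \<open>x\<close> is part of the assertion.
\<close>
definition cong_zero :: "complex \<Rightarrow> int \<Rightarrow> bool" where
  "cong_zero x M \<longleftrightarrow> (\<exists>k::int. x = of_int k \<and> [k = 0] (mod M))"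

end

theory Submission
  imports Defs
begin

text \<open>
  The function \<open>t(z) = (\<theta>\<^sub>2(z) / \<theta>\<^sub>2(5z))\<^sup>2\<close>, an eta quotient, is a Hauptmodul for \<open>\<Gamma>\<^sub>0(10)\<close> with its only pole
  at \<open>\<infinity>\<close>, so every basis function \<open>f\<^sub>m\<close> is a polynomial in \<open>t\<close>. Its \<open>q\<close>-expansion is \<open>q\<^bsup>-1\<^esup> X\<^sup>2\<close> with
  an integral power series \<open>X\<close>; hence all coefficients \<open>a(m,n)\<close> are integers, and modulo \<open>2\<close> only odd powers
  of \<open>q\<close> occur in \<open>t\<close>. As \<open>f\<^sub>m df\<^sub>n\<close> is a polynomial in \<open>t\<close> times \<open>dt\<close>, its residue vanishes, which
  gives the symmetry \<open>m a(n,m) = n a(m,n)\<close> and with it the powers \<open>p\<^bsup>a-b\<^esup>\<close> in both congruences.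
  The additional factor \<open>2\<close> amounts to \<open>a(m,n)\<close> being even whenever \<open>v\<^sub>2(n) > v\<^sub>2(m)\<close>. Modulo \<open>2\<close> one has
  \<open>f\<^sub>2\<^sub>m = f\<^sub>m\<^sup>2\<close>, which reduces this to odd \<open>m\<close>, and there \<open>f\<^sub>m\<close> is odd in \<open>q\<close> because \<open>t\<close> is.

  The modularity of \<open>t\<close> rests on \<open>\<eta>(-1/z)\<^sup>2 = \<kappa> z \<eta>(z)\<^sup>2\<close>: by Liouville's theorem the theta products for \<open>z\<close>
  and \<open>-1/z\<close> are proportional, and comparing them at the three half periods determines the cube of the
  factor. Uniqueness of \<open>f\<^sub>m\<close> follows from the maximum modulus principle, applied to the
  product of the \<open>SL\<^sub>2(\<int>)\<close>-translates of a difference.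
\<close>

subsection \<open>The infinite products\<close>

text \<open>The \<open>q\<close>-Pochhammer symbol (x; q)_\<infinity>. Base and argument are kept
  apart: it is entire in \<open>x\<close> for fixed \<open>q\<close>, while the parity identities
  change the base to q^2.\<close>

definition qprod :: "complex \<Rightarrow> complex \<Rightarrow> complex" where
  "qprod q x = (\<Prod>n. 1 - x * q ^ n)"

text \<open>The product of 1 - q^n over n \<ge> 1, that is, the Dedekind eta function without its
  factor q^(1/24).\<close>

definition euler_fun :: "complex \<Rightarrow> complex" where
  "euler_fun q = qprod q q"

lemma convergent_qprod:
  fixes q x :: complex
  assumes "norm q < 1"
  shows "convergent_prod (\<lambda>n. 1 - x * q ^ n)"
proof -
  have "norm ((1 - x * q ^ n) - 1) = norm x * norm q ^ n" for n
    by (simp add: norm_mult norm_power)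
  then have "summable (\<lambda>n. norm ((1 - x * q ^ n) - 1))"
    using assms by (simp only:) (intro summable_mult summable_geometric, auto)
  then show ?thesis
    by (intro abs_convergent_prod_imp_convergent_prod summable_imp_abs_convergent_prod)
qed

lemma qprod_LIMSEQ:
  assumes "norm q < 1"
  shows "(\<lambda>N. \<Prod>n<N. 1 - x * q ^ n) \<longlonglongrightarrow> qprod q x"
proof -
  have "(\<lambda>N. \<Prod>n\<le>N. 1 - x * q ^ n) \<longlonglongrightarrow> qprod q x"
    unfolding qprod_def by (rule convergent_prod_LIMSEQ[OF convergent_qprod[OF assms]])
  then show ?thesis
    using LIMSEQ_lessThan_iff_atMost[of "\<lambda>A. \<Prod>n\<in>A. 1 - x * q ^ n"] by simp
qed

lemma qprod_Suc:
  assumes "norm q < 1"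
  shows "qprod q x = (1 - x) * qprod q (q * x)"
proof -
  have "(\<lambda>N. \<Prod>n<Suc N. 1 - x * q ^ n) \<longlonglongrightarrow> qprod q x"
    using qprod_LIMSEQ[OF assms] by (rule LIMSEQ_Suc)
  moreover have "(\<Prod>n<Suc N. 1 - x * q ^ n) = (1 - x) * (\<Prod>n<N. 1 - (q * x) * q ^ n)" for N
    by (simp add: prod.lessThan_Suc_shift mult_ac del: prod.lessThan_Suc)
  ultimately have "(\<lambda>N. (1 - x) * (\<Prod>n<N. 1 - (q * x) * q ^ n)) \<longlonglongrightarrow> qprod q x"
    by (simp only:)
  moreover have "(\<lambda>N. (1 - x) * (\<Prod>n<N. 1 - (q * x) * q ^ n)) \<longlonglongrightarrow> (1 - x) * qprod q (q * x)"
    by (intro tendsto_intros qprod_LIMSEQ assms)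
  ultimately show ?thesis
    by (rule LIMSEQ_unique)
qed

lemma qprod_eq_0_iff:
  assumes "norm q < 1"
  shows "qprod q x = 0 \<longleftrightarrow> (\<exists>n. x * q ^ n = 1)"
  using has_prod_eq_0_iff[OF convergent_prod_has_prod[OF convergent_qprod[OF assms, of x]]]
  by (auto simp: qprod_def eq_commute[of 1])

lemma qprod_mult_minus:
  assumes "norm q < 1"
  shows "qprod q x * qprod q (- x) = qprod (q\<^sup>2) (x\<^sup>2)"
proof -
  have n2: "norm (q\<^sup>2) < 1" using assms by (simp add: norm_power power_less_one_iff)
  have "(\<lambda>N. (\<Prod>n<N. 1 - x * q ^ n) * (\<Prod>n<N. 1 - (- x) * q ^ n)) \<longlonglongrightarrow> qprod q x * qprod q (- x)"
    by (intro tendsto_intros qprod_LIMSEQ assms)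
  moreover have "(\<Prod>n<N. 1 - x * q ^ n) * (\<Prod>n<N. 1 - (- x) * q ^ n) = (\<Prod>n<N. 1 - x\<^sup>2 * (q\<^sup>2) ^ n)" for N
    unfolding prod.distrib[symmetric]
    by (intro prod.cong refl) (simp add: algebra_simps power2_eq_square power_mult_distrib)
  ultimately have "(\<lambda>N. \<Prod>n<N. 1 - x\<^sup>2 * (q\<^sup>2) ^ n) \<longlonglongrightarrow> qprod q x * qprod q (- x)"
    by (simp only:)
  then show ?thesis
    using qprod_LIMSEQ[OF n2] by (rule LIMSEQ_unique)
qed

lemma qprod_split_parity:
  assumes "norm q < 1"
  shows "qprod q x = qprod (q\<^sup>2) x * qprod (q\<^sup>2) (q * x)"
proof -
  have n2: "norm (q\<^sup>2) < 1" using assms by (simp add: norm_power power_less_one_iff)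
  have eq: "(\<Prod>n<2*N. 1 - x * q ^ n) = (\<Prod>n<N. 1 - x * (q\<^sup>2) ^ n) * (\<Prod>n<N. 1 - (q * x) * (q\<^sup>2) ^ n)" for N
    by (induction N) (simp_all add: power_mult power2_eq_square power_mult_distrib mult_ac)
  have "(\<lambda>N. \<Prod>n<2*N. 1 - x * q ^ n) \<longlonglongrightarrow> qprod q x"
    by (rule filterlim_compose[OF qprod_LIMSEQ[OF assms] filterlim_subseq]) (simp add: strict_mono_def)
  moreover have "(\<lambda>N. \<Prod>n<2*N. 1 - x * q ^ n) \<longlonglongrightarrow> qprod (q\<^sup>2) x * qprod (q\<^sup>2) (q * x)"
    unfolding eq by (intro tendsto_intros qprod_LIMSEQ n2)
  ultimately show ?thesis
    using LIMSEQ_unique by blast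
qed

text \<open>The Weierstrass M-test for products. Uniform convergence first gives some limit
  function, which is then identified with the infinite product point by point.\<close>

lemma uniform_limit_prodinf_complex:
  fixes f :: "nat \<Rightarrow> 'a :: topological_space \<Rightarrow> complex"
  assumes "\<And>n. continuous_on A (f n)" "compact A" "summable M"
    and "\<And>n x. x \<in> A \<Longrightarrow> norm (f n x - 1) \<le> M n"
  shows "uniform_limit A (\<lambda>N x. \<Prod>n<N. f n x) (\<lambda>x. \<Prod>n. f n x) sequentially"
proof -
  have "uniformly_convergent_on A (\<lambda>N x. \<Sum>n<N. norm (f n x - 1))"
    using assms by (intro Weierstrass_m_test'[where M = M]) auto
  then have "uniformly_convergent_on A (\<lambda>N x. \<Prod>n<N. f n x)"
    by (intro uniformly_convergent_on_prod' assms)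
  then obtain g where g: "uniform_limit A (\<lambda>N x. \<Prod>n<N. f n x) g sequentially"
    by (auto simp: uniformly_convergent_on_def)
  have "g x = (\<Prod>n. f n x)" if "x \<in> A" for x
  proof -
    have "summable (\<lambda>n. norm (f n x - 1))"
      by (rule summable_comparison_test'[OF assms(3), of 0]) (use assms(4) that in auto)
    then have "convergent_prod (\<lambda>n. f n x)"
      by (intro abs_convergent_prod_imp_convergent_prod summable_imp_abs_convergent_prod)
    then have "(\<lambda>N. \<Prod>n\<le>N. f n x) \<longlonglongrightarrow> (\<Prod>n. f n x)"
      by (rule convergent_prod_LIMSEQ)
    then have "(\<lambda>N. \<Prod>n<N. f n x) \<longlonglongrightarrow> (\<Prod>n. f n x)"
      using LIMSEQ_lessThan_iff_atMost[of "\<lambda>A. \<Prod>n\<in>A. f n x"] by simp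
    with tendsto_uniform_limitI[OF g that] show ?thesis
      using LIMSEQ_unique by blast
  qed
  then have "uniform_limit A (\<lambda>N x. \<Prod>n<N. f n x) g sequentially
      \<longleftrightarrow> uniform_limit A (\<lambda>N x. \<Prod>n<N. f n x) (\<lambda>x. \<Prod>n. f n x) sequentially"
    by (intro uniform_limit_cong') auto
  with g show ?thesis
    by blast
qed

lemma holomorphic_qprod:
  assumes "norm q < 1"
  shows "qprod q holomorphic_on UNIV"
proof (rule holomorphic_uniform_sequence)
  show "(\<lambda>x. \<Prod>n<N. 1 - x * q ^ n) holomorphic_on UNIV" for N
    by (intro holomorphic_intros)
  fix z :: complex
  have "uniform_limit (cball z 1) (\<lambda>N x. \<Prod>n<N. 1 - x * q ^ n) (\<lambda>x. \<Prod>n. 1 - x * q ^ n) sequentially"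
  proof (rule uniform_limit_prodinf_complex)
    show "summable (\<lambda>n. (norm z + 1) * norm q ^ n)"
      using assms by (intro summable_mult summable_geometric) auto
    fix n :: nat and x :: complex
    assume x: "x \<in> cball z 1"
    have "norm x = norm (z + (x - z))" by simp
    also have "\<dots> \<le> norm z + norm (x - z)" by (rule norm_triangle_ineq)
    finally have "norm x \<le> norm z + 1"
      using x by (simp add: dist_norm norm_minus_commute)
    then show "norm ((1 - x * q ^ n) - 1) \<le> (norm z + 1) * norm q ^ n"
      by (simp add: norm_mult norm_power mult_right_mono)
  qed (auto intro!: continuous_intros)
  then show "\<exists>d>0. cball z d \<subseteq> UNIV \<and>
      uniform_limit (cball z d) (\<lambda>N x. \<Prod>n<N. 1 - x * q ^ n) (qprod q) sequentially"
    unfolding qprod_def[abs_def] by (intro exI[of _ 1]) simp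
qed simp

text \<open>Uniform convergence in \<open>q\<close> itself serves twice: for the holomorphy of
  \<open>euler_fun\<close> and for the integrality of its Taylor coefficients.\<close>

lemma uniform_limit_euler_fun:
  assumes "r < 1"
  shows "uniform_limit (cball 0 r) (\<lambda>N q. \<Prod>n<N. 1 - q ^ Suc n) euler_fun sequentially"
proof (cases "r < 0")
  case True
  then show ?thesis by simp
next
  case False
  have "uniform_limit (cball 0 r) (\<lambda>N q. \<Prod>n<N. 1 - q ^ Suc n) (\<lambda>q::complex. \<Prod>n. 1 - q ^ Suc n) sequentially"
  proof (rule uniform_limit_prodinf_complex[where M = "\<lambda>n. r ^ Suc n"])
    show "summable (\<lambda>n. r ^ Suc n)"
      using False assms unfolding power_Suc by (intro summable_mult summable_geometric) auto
    fix n :: nat and x :: complex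
    assume x: "x \<in> cball 0 r"
    have "norm ((1 - x ^ Suc n) - 1) = norm x ^ Suc n"
      by (simp add: norm_mult norm_power)
    also have "\<dots> \<le> r ^ Suc n"
      by (rule power_mono) (use x in auto)
    finally show "norm ((1 - x ^ Suc n) - 1) \<le> r ^ Suc n" .
  qed (auto intro!: continuous_intros)
  then show ?thesis
    by (simp add: euler_fun_def[abs_def] qprod_def[abs_def])
qed

lemma holomorphic_euler_fun: "euler_fun holomorphic_on ball 0 1"
proof (rule holomorphic_uniform_sequence)
  show "(\<lambda>q. \<Prod>n<N. 1 - q ^ Suc n) holomorphic_on ball 0 1" for N :: nat
    by (intro holomorphic_intros)
  fix z :: complex
  assume "z \<in> ball 0 1"
  then have z: "norm z < 1" by simp
  define d where "d = (1 - norm z) / 2"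
  have sub: "cball z d \<subseteq> cball 0 ((1 + norm z) / 2)"
  proof
    fix y assume "y \<in> cball z d"
    then have "norm (y - z) \<le> d" by (simp add: dist_norm norm_minus_commute)
    then have "norm y \<le> norm z + d" using norm_triangle_sub[of y z] by linarith
    then show "y \<in> cball 0 ((1 + norm z) / 2)" by (simp add: d_def field_simps)
  qed
  show "\<exists>d>0. cball z d \<subseteq> ball 0 1 \<and>
      uniform_limit (cball z d) (\<lambda>N q. \<Prod>n<N. 1 - q ^ Suc n) euler_fun sequentially"
  proof (intro exI[of _ d] conjI)
    show "d > 0" using z by (simp add: d_def)
    show "cball z d \<subseteq> ball 0 1" proof
      fix y assume "y \<in> cball z d"
      then have "norm y \<le> (1 + norm z) / 2" using sub by auto
      then show "y \<in> ball 0 1" using z by simp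
    qed
    show "uniform_limit (cball z d) (\<lambda>N q. \<Prod>n<N. 1 - q ^ Suc n) euler_fun sequentially"
      by (rule uniform_limit_on_subset[OF uniform_limit_euler_fun sub]) (use z in auto)
  qed
qed simp

lemma euler_fun_nonzero:
  assumes "norm q < 1"
  shows "euler_fun q \<noteq> 0"
proof
  assume "euler_fun q = 0"
  then obtain n where "q * q ^ n = 1"
    using qprod_eq_0_iff[OF assms] by (auto simp: euler_fun_def)
  then have "norm q ^ Suc n = 1"
    by (metis norm_one norm_power power_Suc)
  moreover have "norm q ^ Suc n < 1"
    using assms power_less_one_iff[of "norm q" "Suc n"] by simp
  ultimately show False by linarith
qed

text \<open>Euler's identity \<open>\<Prod>(1 + q\<^sup>n)(1 - q\<^bsup>2n-1\<^esup>) = 1\<close>, with \<open>p\<^sup>2 = q\<close>.\<close>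
lemma qprod_half_periods:
  assumes "norm q < 1" and "p\<^sup>2 = q"
  shows "qprod q (-q) * (qprod q p * qprod q (-p)) = 1"
proof -
  have n2: "norm (q\<^sup>2) < 1" using assms by (simp add: norm_power power_less_one_iff)
  have a: "qprod q p * qprod q (-p) = qprod (q\<^sup>2) q"
    using qprod_mult_minus[OF assms(1), of p] assms(2) by simp
  have b: "qprod q q * qprod q (-q) = qprod (q\<^sup>2) (q\<^sup>2)"
    by (rule qprod_mult_minus[OF assms(1)])
  have c: "qprod q q = qprod (q\<^sup>2) q * qprod (q\<^sup>2) (q\<^sup>2)"
    using qprod_split_parity[OF assms(1), of q] by (simp add: power2_eq_square)
  have nz: "qprod (q\<^sup>2) (q\<^sup>2) \<noteq> 0"
    using euler_fun_nonzero[OF n2] by (simp add: euler_fun_def)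
  have "qprod (q\<^sup>2) (q\<^sup>2) * (qprod q (-q) * qprod (q\<^sup>2) q) = qprod q q * qprod q (-q)"
    unfolding c by (simp only: mult_ac)
  with b nz show ?thesis
    unfolding a by simp
qed

subsection \<open>Quasi-elliptic functions\<close>

definition e2pi :: "complex \<Rightarrow> complex" where
  "e2pi z = exp (2 * of_real pi * \<i> * z)"

lemma e2pi_0 [simp]: "e2pi 0 = 1"
  by (simp add: e2pi_def)

lemma e2pi_nonzero [simp]: "e2pi z \<noteq> 0"
  by (simp add: e2pi_def)

lemma e2pi_add: "e2pi (w + z) = e2pi w * e2pi z"
  by (simp add: e2pi_def exp_add ring_distribs)

lemma e2pi_minus: "e2pi (- z) = inverse (e2pi z)"
  by (simp add: e2pi_def exp_minus)

lemma e2pi_diff: "e2pi (w - z) = e2pi w / e2pi z"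
  by (simp add: e2pi_def exp_diff ring_distribs)

lemma e2pi_of_nat_mult: "e2pi (of_nat n * z) = e2pi z ^ n"
  by (simp add: e2pi_def exp_of_nat_mult[symmetric] mult_ac)

lemma e2pi_numeral_mult: "e2pi (numeral n * z) = e2pi z ^ numeral n"
  using e2pi_of_nat_mult[of "numeral n" z] by simp

lemma e2pi_eq_1_iff: "e2pi z = 1 \<longleftrightarrow> (\<exists>n::int. z = of_int n)"
proof
  assume "e2pi z = 1"
  then obtain n :: int where "Im z = 0" "Re z = of_int n"
    by (auto simp: e2pi_def exp_eq_1)
  then show "\<exists>n::int. z = of_int n"
    by (intro exI[of _ n]) (simp add: complex_eq_iff)
next
  assume "\<exists>n::int. z = of_int n"
  then show "e2pi z = 1"
    by (auto simp: e2pi_def exp_eq_1)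
qed

lemma e2pi_of_int [simp]: "e2pi (of_int n) = 1"
  by (auto simp: e2pi_eq_1_iff)

lemma e2pi_1 [simp]: "e2pi 1 = 1"
  using e2pi_of_int[of 1] by simp

lemma e2pi_half [simp]: "e2pi (1 / 2) = - 1"
  by (simp add: e2pi_def)

lemma e2pi_quarter [simp]: "e2pi (1 / 4) = \<i>"
proof -
  have "e2pi (1 / 4) = exp (of_real (pi / 2) * \<i>)"
    unfolding e2pi_def by (rule arg_cong[of _ _ exp]) (simp add: field_simps)
  also have "\<dots> = cis (pi / 2)"
    by (simp add: cis_conv_exp mult_ac)
  finally show ?thesis by simp
qed

lemma norm_e2pi: "norm (e2pi z) = exp (- 2 * pi * Im z)"
  by (simp add: e2pi_def)

lemma norm_e2pi_less_1_iff: "norm (e2pi z) < 1 \<longleftrightarrow> Im z > 0"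
  by (simp add: norm_e2pi zero_less_mult_iff)

lemma holomorphic_e2pi [holomorphic_intros]:
  "f holomorphic_on A \<Longrightarrow> (\<lambda>z. e2pi (f z)) holomorphic_on A"
  unfolding e2pi_def by (intro holomorphic_intros)

lemma has_field_derivative_e2pi: "(e2pi has_field_derivative 2 * of_real pi * \<i> * e2pi z) (at z)"
  unfolding e2pi_def[abs_def] by (auto intro!: derivative_eq_intros)

section \<open>Rigidity of functions with the quasi-periods 1 and z\<close>

lemma periodic_lattice:
  fixes f :: "complex \<Rightarrow> 'a"
  assumes "\<And>w. f (w + 1) = f w" "\<And>w. f (w + z) = f w"
  shows "f (w + of_int m + of_int n * z) = f w"
proof -
  have *: "f (w + of_int k * v) = f w" if "\<And>w. f (w + v) = f w" for w v and k :: int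
  proof (induction k arbitrary: w rule: int_induct[where k = 0])
    case (step1 k)
    then show ?case using that[of "w + of_int k * v"] by (simp add: ring_distribs add_ac)
  next
    case (step2 k)
    then show ?case using that[of "w + of_int (k - 1) * v"] by (simp add: ring_distribs add_ac)
  qed simp
  show ?thesis
    using *[OF assms(2), of "w + of_int m" n] *[OF assms(1), of w m] by simp
qed

text \<open>The quotient of two such functions is entire and elliptic, hence constant.\<close>
lemma quasi_elliptic_proportional:
  assumes z: "Im z > 0"
    and hol: "f holomorphic_on UNIV" "g holomorphic_on UNIV"
    and per: "\<And>w. f (w + 1) = f w" "\<And>w. g (w + 1) = g w"
      "\<And>w. f (w + z) = \<mu> w * f w" "\<And>w. g (w + z) = \<mu> w * g w"
    and \<mu>: "\<And>w. \<mu> w \<noteq> 0"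
    and zeros: "\<And>w. g w = 0 \<longleftrightarrow> (\<exists>m n :: int. w = of_int m + of_int n * z)"
    and der: "(f has_field_derivative f') (at 0)" "(g has_field_derivative g') (at 0)" "g' \<noteq> 0"
    and "f 0 = 0"
  shows "f w = f' / g' * g w"
proof -
  \<comment> \<open>At a zero of \<open>g\<close> the quotient gets its limit at 0; by periodicity
    this is the correct value at every lattice point.\<close>
  define \<phi> where "\<phi> w = (if g w = 0 then f' / g' else f w / g w)" for w
  have \<phi>1: "\<phi> (w + 1) = \<phi> w" and \<phi>z: "\<phi> (w + z) = \<phi> w" for w
    using \<mu>[of w] by (auto simp: \<phi>_def per)
  note \<phi>_per = periodic_lattice[of \<phi>, OF \<phi>1 \<phi>z]
  have g0: "g 0 = 0"
    using zeros[of 0] by (auto intro!: exI[of _ 0])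
  have gl: "((\<lambda>w. g w / w) \<longlongrightarrow> g') (at 0)" and fl: "((\<lambda>w. f w / w) \<longlongrightarrow> f') (at 0)"
    using der(1,2) \<open>f 0 = 0\<close> g0 by (auto simp: has_field_derivative_iff)
  have "eventually (\<lambda>w. g w / w \<noteq> 0) (at 0)"
    using tendsto_imp_eventually_ne[OF gl der(3)] .
  then obtain \<epsilon> where \<epsilon>: "\<epsilon> > 0" "\<And>w. w \<noteq> 0 \<Longrightarrow> dist w 0 < \<epsilon> \<Longrightarrow> g w / w \<noteq> 0"
    unfolding eventually_at by auto
  have gnz: "g w \<noteq> 0" if "w \<in> ball 0 \<epsilon> - {0}" for w
    using \<epsilon>(2)[of w] that by auto
  have "((\<lambda>w. (f w / w) / (g w / w)) \<longlongrightarrow> f' / g') (at 0)"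
    by (intro tendsto_divide fl gl der)
  then have "(\<phi> \<longlongrightarrow> f' / g') (at 0)"
  proof (rule Lim_transform_eventually)
    have "eventually (\<lambda>w. w \<in> ball 0 \<epsilon> - {0}) (at 0)"
      using \<epsilon>(1) by (intro eventually_at_in_open) auto
    then show "eventually (\<lambda>w. (f w / w) / (g w / w) = \<phi> w) (at 0)"
      by eventually_elim (use gnz in \<open>auto simp: \<phi>_def\<close>)
  qed
  then have lim0: "(\<phi> \<longlongrightarrow> \<phi> 0) (at 0)"
    by (simp add: \<phi>_def g0)
  have "\<phi> holomorphic_on ball 0 \<epsilon>"
  proof (rule no_isolated_singularity'[where K = "{0}"])
    show "(\<phi> \<longlongrightarrow> \<phi> z) (at z within ball 0 \<epsilon>)" if "z \<in> {0}" for z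
      using lim0 that by (auto intro: tendsto_within_subset)
    have "(\<lambda>w. f w / g w) holomorphic_on ball 0 \<epsilon> - {0}"
      using gnz by (intro holomorphic_on_divide holomorphic_on_subset[OF hol(1)]
          holomorphic_on_subset[OF hol(2)]) auto
    then show "\<phi> holomorphic_on ball 0 \<epsilon> - {0}"
      by (rule holomorphic_transform) (use gnz in \<open>auto simp: \<phi>_def\<close>)
  qed auto
  then have diff0: "\<phi> field_differentiable at 0"
    using \<epsilon>(1) by (intro holomorphic_on_imp_differentiable_at[of _ "ball 0 \<epsilon>"]) auto
  have "\<phi> field_differentiable at w" for w
  proof (cases "g w = 0")
    case False
    define U where "U = {w. g w \<noteq> 0}"
    have "continuous_on UNIV g"
      using hol(2) by (rule holomorphic_on_imp_continuous_on)
    then have "open U"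
      unfolding U_def by (intro open_Collect_neq continuous_intros) auto
    have "(\<lambda>w. f w / g w) holomorphic_on U"
      by (intro holomorphic_on_divide holomorphic_on_subset[OF hol(1)]
          holomorphic_on_subset[OF hol(2)]) (auto simp: U_def)
    then have "\<phi> holomorphic_on U"
      by (rule holomorphic_transform) (auto simp: \<phi>_def U_def)
    then show ?thesis
      using \<open>open U\<close> False by (intro holomorphic_on_imp_differentiable_at[of _ U]) (auto simp: U_def)
  next
    case True
    then obtain m n :: int where w: "w = of_int m + of_int n * z"
      using zeros by blast
    \<comment> \<open>Every other singularity is the one at 0 moved by a period.\<close>
    have eq: "\<phi> = \<phi> \<circ> (\<lambda>u. u - w)"
      using \<phi>_per[of "_ - w" m n] by (auto simp: w fun_eq_iff algebra_simps)
    have "\<phi> \<circ> (\<lambda>u. u - w) field_differentiable at w"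
      by (rule field_differentiable_compose) (auto intro!: derivative_intros simp: diff0)
    then show ?thesis
      using eq by simp
  qed
  then have hol_\<phi>: "\<phi> holomorphic_on UNIV"
    by (simp add: field_differentiable_def holomorphic_on_open)
  \<comment> \<open>A closed fundamental parallelogram: compact, and by periodicity
    \<open>\<phi>\<close> takes all its values there.\<close>
  define P where "P = (\<lambda>(s, t). of_real s + of_real t * z) ` ({0..1::real} \<times> {0..1::real})"
  have "compact P"
    unfolding P_def by (intro compact_continuous_image compact_Times)
      (auto intro!: continuous_intros simp: case_prod_unfold)
  then have "bounded (\<phi> ` P)"
    using holomorphic_on_imp_continuous_on[OF hol_\<phi>]
    by (intro compact_imp_bounded compact_continuous_image) (auto intro: continuous_on_subset)
  moreover have "range \<phi> \<subseteq> \<phi> ` P"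
  proof safe
    fix w :: complex
    define t where "t = Im w / Im z"
    define s where "s = Re w - t * Re z"
    have w: "w = of_real s + of_real t * z"
      using z by (auto simp: complex_eq_iff s_def t_def)
    define v where "v = of_real (frac s) + of_real (frac t) * z"
    have "v \<in> P"
      unfolding P_def v_def
      by (rule image_eqI[of _ _ "(frac s, frac t)"]) (auto simp: frac_ge_0 less_imp_le[OF frac_lt_1])
    moreover have "w = v + of_int \<lfloor>s\<rfloor> + of_int \<lfloor>t\<rfloor> * z"
      by (subst w) (simp add: v_def frac_def algebra_simps)
    then have "\<phi> w = \<phi> v"
      using \<phi>_per by simp
    ultimately show "\<phi> w \<in> \<phi> ` P"
      by simp
  qed
  ultimately have "\<phi> constant_on UNIV"
    using bounded_subset by (intro Liouville_theorem hol_\<phi>) blast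
  then have "\<phi> w = \<phi> 0"
    by (auto simp: constant_on_def)
  then have \<phi>w: "\<phi> w = f' / g'"
    by (simp add: \<phi>_def g0)
  show ?thesis
  proof (cases "g w = 0")
    case False
    then show ?thesis using \<phi>w by (simp add: \<phi>_def field_simps)
  next
    case True
    then obtain m n :: int where w: "w = of_int m + of_int n * z"
      using zeros by blast
    \<comment> \<open>At a zero of \<open>g\<close> the value of \<open>\<phi>\<close> says nothing
      about \<open>f\<close>. There the lattice lemma is applied to the predicate
      \<open>f w = 0\<close>, which is periodic because the multiplier never vanishes.\<close>
    have "(f u = 0) = (f (u + z) = 0)" for u
      using \<mu> per by simp
    then have "(f w = 0) = (f 0 = 0)"
      using periodic_lattice[of "\<lambda>w. f w = 0" z 0 m n] w by (simp add: per)
    then show ?thesis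
      using True \<open>f 0 = 0\<close> by simp
  qed
qed

subsection \<open>The inversion formula for the square of the eta function\<close>

text \<open>With x = e2pi w and q = e2pi z this is (x; q)_\<infinity> (q/x; q)_\<infinity>, the
  Jacobi triple product without the factors 1 - q^n.\<close>

definition theta_prod :: "complex \<Rightarrow> complex \<Rightarrow> complex" where
  "theta_prod z w = qprod (e2pi z) (e2pi w) * qprod (e2pi z) (e2pi z * e2pi (- w))"

text \<open>Both sides consist of the same two factors in opposite order. The behaviour under the
  period \<open>z\<close> thus reduces to the reflection w \<mapsto> -w.\<close>

lemma theta_prod_minus_eq: "theta_prod z (w + z) = theta_prod z (- w)"
proof -
  have "e2pi (w + z) = e2pi z * e2pi (- (- w))" "e2pi z * e2pi (- (w + z)) = e2pi (- w)"
    unfolding e2pi_add[symmetric] by (simp_all add: add_ac)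
  then show ?thesis
    unfolding theta_prod_def by (simp only: mult.commute)
qed

lemma theta_prod_add_1: "theta_prod z (w + 1) = theta_prod z w"
  by (simp add: theta_prod_def e2pi_diff e2pi_add e2pi_minus)

text \<open>Splitting off the first factor of one product on each side leaves the comparison of 1 -
  1/x with 1 - x, where x = e2pi w.\<close>

lemma theta_prod_minus:
  assumes "Im z > 0"
  shows "theta_prod z (- w) = - e2pi (- w) * theta_prod z w"
proof -
  have q: "norm (e2pi z) < 1"
    using assms by (simp add: norm_e2pi_less_1_iff)
  show ?thesis
    unfolding theta_prod_def qprod_Suc[OF q, of "e2pi w"] qprod_Suc[OF q, of "e2pi (-w)"]
    by (simp add: e2pi_minus field_simps)
qed

lemma theta_prod_add_period:
  assumes "Im z > 0"
  shows "theta_prod z (w + z) = - e2pi (- w) * theta_prod z w"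
  using theta_prod_minus[OF assms] by (simp add: theta_prod_minus_eq)

lemma theta_prod_diff_period:
  assumes "Im z > 0"
  shows "theta_prod z (w - z) = - e2pi (w - z) * theta_prod z w"
  using theta_prod_add_period[OF assms, of "w - z"] by (simp add: e2pi_diff)

text \<open>The first product vanishes at the lattice points whose coefficient of \<open>z\<close>
  is at most 0, the second at those where it is at least 1.\<close>

lemma theta_prod_eq_0_iff:
  assumes "Im z > 0"
  shows "theta_prod z w = 0 \<longleftrightarrow> (\<exists>m n :: int. w = of_int m + of_int n * z)"
proof -
  have q: "norm (e2pi z) < 1"
    using assms by (simp add: norm_e2pi_less_1_iff)
  have *: "e2pi v * e2pi z ^ n = e2pi (v + of_nat n * z)" for v n
    by (simp add: e2pi_add e2pi_of_nat_mult)
  have "theta_prod z w = 0 \<longleftrightarrow>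
      (\<exists>n::nat. e2pi (w + of_nat n * z) = 1) \<or> (\<exists>n::nat. e2pi ((z - w) + of_nat n * z) = 1)"
    by (simp add: theta_prod_def qprod_eq_0_iff[OF q] * e2pi_add[symmetric])
  also have "\<dots> \<longleftrightarrow> (\<exists>m n :: int. w = of_int m + of_int n * z)"
    unfolding e2pi_eq_1_iff
  proof safe
    fix n :: nat and m :: int
    assume "w + of_nat n * z = of_int m"
    then have "w = of_int m + of_int (- int n) * z"
      by (simp add: algebra_simps)
    then show "\<exists>m n :: int. w = of_int m + of_int n * z" by blast
  next
    fix n :: nat and m :: int
    assume "z - w + of_nat n * z = of_int m"
    then have "w = of_int (- m) + of_int (int n + 1) * z"
      by (simp add: algebra_simps)
    then show "\<exists>m n :: int. w = of_int m + of_int n * z" by blast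
  next
    fix m n :: int
    assume no: "\<nexists>k i. z - (of_int m + of_int n * z) + of_nat k * z = of_int i"
    show "\<exists>k i. of_int m + of_int n * z + of_nat k * z = of_int i"
    proof (cases "n \<le> 0")
      case True
      then show ?thesis
        by (intro exI[of _ "nat (- n)"] exI[of _ m]) (simp add: algebra_simps)
    next
      case False
      then have "z - (of_int m + of_int n * z) + of_nat (nat (n - 1)) * z = of_int (- m)"
        by (simp add: algebra_simps)
      then show ?thesis using no by blast
    qed
  qed
  finally show ?thesis .
qed

lemma holomorphic_theta_prod:
  assumes "Im z > 0"
  shows "theta_prod z holomorphic_on UNIV"
proof -
  have q: "norm (e2pi z) < 1"
    using assms by (simp add: norm_e2pi_less_1_iff)
  note qp = holomorphic_qprod[OF q]
  have "(qprod (e2pi z) \<circ> (\<lambda>w. e2pi w)) holomorphic_on UNIV"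
    "(qprod (e2pi z) \<circ> (\<lambda>w. e2pi z * e2pi (- w))) holomorphic_on UNIV"
    by (rule holomorphic_on_compose_gen[OF _ qp]; auto intro!: holomorphic_intros)+
  then show ?thesis
    unfolding theta_prod_def[abs_def] by (intro holomorphic_on_mult) (simp_all add: o_def)
qed

lemma theta_prod_0 [simp]:
  assumes "Im z > 0"
  shows "theta_prod z 0 = 0"
  using theta_prod_eq_0_iff[OF assms, of 0] by (auto intro!: exI[of _ 0])

text \<open>Only the factor 1 - e2pi w vanishes at 0, so the derivative is - 2 \<pi> i times the
  value of the remaining product \<open>B\<close> there.\<close>

lemma has_field_derivative_theta_prod_0:
  assumes "Im z > 0"
  shows "(theta_prod z has_field_derivative - (2 * of_real pi * \<i>) * euler_fun (e2pi z) ^ 2) (at 0)"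
proof -
  have q: "norm (e2pi z) < 1"
    using assms by (simp add: norm_e2pi_less_1_iff)
  define B where "B w = qprod (e2pi z) (e2pi z * e2pi w) * qprod (e2pi z) (e2pi z * e2pi (- w))" for w
  note qp = holomorphic_qprod[OF q]
  have "(qprod (e2pi z) \<circ> (\<lambda>w. e2pi z * e2pi w)) holomorphic_on UNIV"
    "(qprod (e2pi z) \<circ> (\<lambda>w. e2pi z * e2pi (- w))) holomorphic_on UNIV"
    by (rule holomorphic_on_compose_gen[OF _ qp]; auto intro!: holomorphic_intros)+
  then have "B holomorphic_on UNIV"
    unfolding B_def[abs_def] by (intro holomorphic_on_mult) (simp_all add: o_def)
  then obtain B' where B': "(B has_field_derivative B') (at 0)"
    using holomorphic_on_imp_differentiable_at[of B UNIV 0] by (auto simp: field_differentiable_def)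
  have eq: "theta_prod z = (\<lambda>w. (1 - e2pi w) * B w)"
    by (auto simp: theta_prod_def B_def qprod_Suc[OF q, of "e2pi _"] fun_eq_iff)
  have B0: "B 0 = euler_fun (e2pi z) ^ 2"
    by (simp add: B_def euler_fun_def power2_eq_square)
  show ?thesis
    unfolding eq
    by (rule derivative_eq_intros has_field_derivative_e2pi B' | simp)+ (simp add: B0)
qed

text \<open>The three values are, up to the factor 2 = 1 - (-1), squares of the products in Euler's
  identity. That their product does not depend on \<open>z\<close> is what determines the constant
  of the inversion formula up to cube roots of unity.\<close>

lemma theta_prod_half_periods:
  assumes "Im z > 0"
  shows "theta_prod z (1 / 2) * theta_prod z (z / 2) * theta_prod z ((1 + z) / 2) = 2"
proof -
  have q: "norm (e2pi z) < 1"
    using assms by (simp add: norm_e2pi_less_1_iff)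
  define p where "p = e2pi (z / 2)"
  have p: "p\<^sup>2 = e2pi z"
    unfolding p_def e2pi_numeral_mult[symmetric] by simp
  have pz: "e2pi z = p * p"
    using p by (simp add: power2_eq_square)
  have [simp]: "p \<noteq> 0" by (simp add: p_def)
  have 1: "theta_prod z (1 / 2) = 2 * qprod (e2pi z) (- e2pi z) ^ 2"
    using qprod_Suc[OF q, of "- 1"] by (simp add: theta_prod_def e2pi_minus power2_eq_square)
  have 2: "theta_prod z (z / 2) = qprod (e2pi z) p ^ 2"
    by (simp add: theta_prod_def e2pi_minus power2_eq_square p_def[symmetric] pz mult.assoc)
  have h: "e2pi ((1 + z) / 2) = - p"
    using e2pi_add[of "1/2" "z/2"] by (simp add: p_def add_divide_distrib)
  have 3: "theta_prod z ((1 + z) / 2) = qprod (e2pi z) (- p) ^ 2"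
    by (simp add: theta_prod_def e2pi_minus h power2_eq_square pz mult.assoc)
  have "theta_prod z (1 / 2) * theta_prod z (z / 2) * theta_prod z ((1 + z) / 2) =
      2 * (qprod (e2pi z) (- e2pi z) * (qprod (e2pi z) p * qprod (e2pi z) (- p))) ^ 2"
    unfolding 1 2 3 power_mult_distrib by (simp only: mult_ac)
  also have "\<dots> = 2"
    by (subst qprod_half_periods[OF q p]) simp
  finally show ?thesis .
qed

lemma Im_uminus_inverse_pos: "Im z > 0 \<Longrightarrow> Im (- 1 / z) > 0"
  by (auto simp: Im_divide power2_eq_square zero_less_divide_iff add_nonneg_pos)

text \<open>Both sides have the same multipliers under w \<mapsto> w + 1 and w \<mapsto> w + z and
  vanish at 0, so they are proportional; the factor is the quotient of the derivatives at 0.\<close>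

lemma theta_prod_inversion:
  assumes z: "Im z > 0"
  shows "e2pi (- (w\<^sup>2) / (2 * z) + (1 / 2 - 1 / (2 * z)) * w) * theta_prod (- 1 / z) (w / z) =
    (euler_fun (e2pi (- 1 / z)) ^ 2 / (z * euler_fun (e2pi z) ^ 2)) * theta_prod z w"
proof -
  define z' where "z' = - 1 / z"
  have z': "Im z' > 0"
    unfolding z'_def by (rule Im_uminus_inverse_pos[OF z])
  have z0: "z \<noteq> 0" using z by auto
  have zz': "z = - 1 / z'" by (simp add: z'_def)
  \<comment> \<open>The quadratic exponent is chosen so that its increments under the two periods
    turn the multipliers of w \<mapsto> theta_prod z' (w / z) into those of
    \<open>theta_prod z\<close>.\<close>
  define u where "u w = - (w\<^sup>2) / (2 * z) + (1 / 2 - 1 / (2 * z)) * w" for w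
  define f where "f w = e2pi (u w) * theta_prod z' (w / z)" for w
  have u1: "u (w + 1) = u w + (1 / 2 - 1 / z - w / z)" for w
    using z0 by (simp add: u_def field_simps power2_eq_square)
  have uz: "u (w + z) = u w + (- w - 1 / 2)" for w
    using z0 by (simp add: u_def field_simps power2_eq_square)
  have e1: "e2pi (1 / 2 - 1 / z - v) * e2pi (v - z') = - 1" for v
    unfolding e2pi_add[symmetric] by (simp add: z'_def)
  have ez: "e2pi (- v - 1 / 2) = - e2pi (- v)" for v
    using e2pi_diff[of "- v" "1 / 2"] by simp
  have f1: "f (w + 1) = f w" for w
  proof -
    have "(w + 1) / z = w / z - z'"
      by (simp add: z'_def add_divide_distrib)
    then have "f (w + 1) = - (e2pi (1 / 2 - 1 / z - w / z) * e2pi (w / z - z')) * f w"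
      unfolding f_def u1 e2pi_add by (simp add: theta_prod_diff_period[OF z'])
    then show ?thesis
      unfolding e1 by simp
  qed
  have fz: "f (w + z) = (- e2pi (- w)) * f w" for w
  proof -
    have "(w + z) / z = w / z + 1"
      using z0 by (simp add: add_divide_distrib)
    then show ?thesis
      unfolding f_def uz e2pi_add[of "u w"] ez by (simp add: theta_prod_add_1)
  qed
  have holf: "f holomorphic_on UNIV"
  proof -
    have "(theta_prod z' \<circ> (\<lambda>w. w / z)) holomorphic_on UNIV"
      by (rule holomorphic_on_compose_gen[OF _ holomorphic_theta_prod[OF z']])
        (auto intro!: holomorphic_intros simp: z0)
    then show ?thesis
      unfolding f_def[abs_def] u_def
      by (intro holomorphic_intros) (simp_all add: o_def z0)
  qed
  have derf: "(f has_field_derivative - (2 * of_real pi * \<i>) * euler_fun (e2pi z') ^ 2 / z) (at 0)"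
  proof -
    have d: "(theta_prod z' has_field_derivative - (2 * of_real pi * \<i>) * euler_fun (e2pi z') ^ 2)
        (at (0 / z))"
      using has_field_derivative_theta_prod_0[OF z'] by simp
    have d1: "((\<lambda>w. theta_prod z' (w / z)) has_field_derivative
        - (2 * of_real pi * \<i>) * euler_fun (e2pi z') ^ 2 * (1 / z)) (at 0)"
      by (rule DERIV_chain2[where g = "\<lambda>w. w / z", OF d]) (auto intro!: derivative_eq_intros simp: z0)
    have "(\<lambda>w. e2pi (u w)) holomorphic_on UNIV"
      unfolding u_def using z0 by (intro holomorphic_intros) auto
    \<comment> \<open>In the product rule \<open>d'\<close> is multiplied by
      \<open>theta_prod z' 0\<close>, which is 0.\<close>
    then obtain d' where d2: "((\<lambda>w. e2pi (u w)) has_field_derivative d') (at 0)"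
      using holomorphic_on_imp_differentiable_at[of "\<lambda>w. e2pi (u w)" UNIV 0]
      by (auto simp: field_differentiable_def)
    show ?thesis
      unfolding f_def[abs_def]
      using DERIV_mult[OF d2 d1] by (simp add: z' u_def)
  qed
  have "f w = (- (2 * of_real pi * \<i>) * euler_fun (e2pi z') ^ 2 / z) /
      (- (2 * of_real pi * \<i>) * euler_fun (e2pi z) ^ 2) * theta_prod z w"
  proof (rule quasi_elliptic_proportional[OF z holf holomorphic_theta_prod[OF z] f1
      theta_prod_add_1 fz theta_prod_add_period[OF z] _ theta_prod_eq_0_iff[OF z] derf
      has_field_derivative_theta_prod_0[OF z]])
    show "- (2 * of_real pi * \<i>) * euler_fun (e2pi z) ^ 2 \<noteq> 0"
      using euler_fun_nonzero[of "e2pi z"] z by (simp add: norm_e2pi_less_1_iff)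
    show "f 0 = 0"
      by (simp add: f_def z')
  qed auto
  then show ?thesis
    by (simp add: f_def u_def z'_def)
qed

text \<open>This is \<open>\<eta>\<^sup>2\<close> for the Dedekind eta function \<open>\<eta>\<close>.\<close>
definition eta_sq :: "complex \<Rightarrow> complex" where
  "eta_sq z = e2pi (z / 12) * euler_fun (e2pi z) ^ 2"

lemma eta_sq_nonzero: "Im z > 0 \<Longrightarrow> eta_sq z \<noteq> 0"
  by (simp add: eta_sq_def euler_fun_nonzero norm_e2pi_less_1_iff)

lemma holomorphic_eta_sq: "eta_sq holomorphic_on {z. Im z > 0}"
proof -
  have "(euler_fun \<circ> (\<lambda>z. e2pi z)) holomorphic_on {z. Im z > 0}"
    by (rule holomorphic_on_compose_gen[OF _ holomorphic_euler_fun])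
      (auto intro!: holomorphic_intros simp: norm_e2pi_less_1_iff)
  then show ?thesis
    unfolding eta_sq_def[abs_def] by (intro holomorphic_intros) (simp_all add: o_def)
qed

text \<open>Division by \<open>z\<close> carries the half periods for \<open>z\<close> to those for
  -1/z, up to sign and periods. Multiplying the inversion formula over all three makes both theta
  products equal to 2, and the cube of the constant remains.\<close>

lemma eta_sq_inversion_cube:
  assumes z: "Im z > 0"
  shows "(eta_sq (- 1 / z) / (z * eta_sq z)) ^ 3 = \<i>"
proof -
  define z' where "z' = - 1 / z"
  have z': "Im z' > 0"
    unfolding z'_def by (rule Im_uminus_inverse_pos[OF z])
  have z0: "z \<noteq> 0" using z by auto
  define C where "C = euler_fun (e2pi z') ^ 2 / (z * euler_fun (e2pi z) ^ 2)"
  define u where "u w = - (w\<^sup>2) / (2 * z) + (1 / 2 - 1 / (2 * z)) * w" for w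
  have inv: "C * theta_prod z w = e2pi (u w) * theta_prod z' (w / z)" for w
    using theta_prod_inversion[OF z, of w] by (simp add: C_def u_def z'_def)
  have t1: "theta_prod z' ((1 / 2) / z) = - e2pi (1 / (2 * z)) * theta_prod z' (z' / 2)"
    using theta_prod_minus[OF z', of "z' / 2"] by (simp add: z'_def mult.commute)
  have t2: "theta_prod z' ((z / 2) / z) = theta_prod z' (1 / 2)"
    using z0 by simp
  have "((1 + z) / 2) / z = (1 + z') / 2 - z'"
    using z0 by (simp add: z'_def field_simps)
  then have t3: "theta_prod z' (((1 + z) / 2) / z) =
      - e2pi (((1 + z) / 2) / z) * theta_prod z' ((1 + z') / 2)"
    using theta_prod_diff_period[OF z', of "(1 + z') / 2"] by simp
  have "C ^ 3 * 2 = (C * theta_prod z (1 / 2)) * (C * theta_prod z (z / 2)) *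
      (C * theta_prod z ((1 + z) / 2))"
    by (subst theta_prod_half_periods[OF z, symmetric]) (simp add: power3_eq_cube)
  also have "\<dots> = e2pi (u (1 / 2)) * e2pi (1 / (2 * z)) * e2pi (u (z / 2)) *
      e2pi (u ((1 + z) / 2)) * e2pi (((1 + z) / 2) / z) *
      (theta_prod z' (1 / 2) * theta_prod z' (z' / 2) * theta_prod z' ((1 + z') / 2))"
    unfolding inv t1 t2 t3 by (simp add: mult_ac)
  also have "\<dots> = e2pi (u (1 / 2) + 1 / (2 * z) + u (z / 2) + u ((1 + z) / 2) +
      ((1 + z) / 2) / z) * 2"
    unfolding theta_prod_half_periods[OF z'] e2pi_add ..
  also have "u (1 / 2) + 1 / (2 * z) + u (z / 2) + u ((1 + z) / 2) + ((1 + z) / 2) / z =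
      1 / 4 + (z - z') / 4"
    using z0 by (simp add: u_def z'_def field_simps power2_eq_square)
  finally have C3: "C ^ 3 = \<i> * e2pi ((z - z') / 4)"
    by (simp add: e2pi_add)
  have "eta_sq z' / (z * eta_sq z) = C * e2pi ((z' - z) / 12)"
    using z0 by (simp add: eta_sq_def C_def e2pi_diff diff_divide_distrib mult_ac)
  then have "(eta_sq z' / (z * eta_sq z)) ^ 3 = C ^ 3 * e2pi (3 * ((z' - z) / 12))"
    by (simp only: power_mult_distrib e2pi_numeral_mult)
  also have "\<dots> = \<i> * e2pi ((z - z') / 4 + 3 * ((z' - z) / 12))"
    unfolding C3 e2pi_add by simp
  \<comment> \<open>The factor e2pi (z / 12) in \<open>eta_sq\<close> exactly absorbs the remaining
    exponential.\<close>
  also have "(z - z') / 4 + 3 * ((z' - z) / 12) = 0"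
    by (simp add: field_simps)
  finally show ?thesis
    by (simp add: z'_def)
qed

section \<open>From the cube to the inversion formula\<close>

lemma open_upper_half: "open {z. Im z > 0}"
  by (rule open_halfspace_Im_gt)

lemma connected_upper_half: "connected {z. Im z > 0}"
  by (intro convex_connected convex_halfspace_Im_gt)

text \<open>The quotient is continuous on a connected set with values among the three cube roots of
  i, hence constant.\<close>

lemma eta_sq_inversion:
  obtains \<kappa> where "\<And>z. Im z > 0 \<Longrightarrow> eta_sq (- 1 / z) = \<kappa> * z * eta_sq z" "\<kappa>\<^sup>2 = - 1"
proof -
  define h where "h z = eta_sq (- 1 / z) / (z * eta_sq z)" for z
  have "(eta_sq \<circ> (\<lambda>z. - 1 / z)) holomorphic_on {z. Im z > 0}"
    by (rule holomorphic_on_compose_gen[OF _ holomorphic_eta_sq])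
      (use Im_uminus_inverse_pos in \<open>auto intro!: holomorphic_intros\<close>)
  then have "h holomorphic_on {z. Im z > 0}"
    unfolding h_def[abs_def]
    by (intro holomorphic_intros holomorphic_eta_sq) (auto simp: o_def eta_sq_nonzero)
  then have cont: "continuous_on {z. Im z > 0} h"
    by (rule holomorphic_on_imp_continuous_on)
  have "finite {x. poly [:- \<i>, 0, 0, 1:] x = 0}"
    by (rule poly_roots_finite) simp
  moreover have "h ` {z. Im z > 0} \<subseteq> {x. poly [:- \<i>, 0, 0, 1:] x = 0}"
    using eta_sq_inversion_cube by (auto simp: h_def power3_eq_cube mult.assoc)
  ultimately have "finite (h ` {z. Im z > 0})"
    using finite_subset by blast
  then have "h constant_on {z. Im z > 0}"
    using continuous_finite_range_constant[OF connected_upper_half cont] by blast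
  then obtain \<kappa> where \<kappa>: "\<And>z. Im z > 0 \<Longrightarrow> h z = \<kappa>"
    by (auto simp: constant_on_def)
  have 1: "eta_sq (- 1 / z) = \<kappa> * z * eta_sq z" if "Im z > 0" for z
  proof -
    have "z \<noteq> 0" using that by auto
    then show ?thesis
      using \<kappa>[OF that] eta_sq_nonzero[OF that] by (auto simp: h_def field_simps)
  qed
  \<comment> \<open>The fixed point i of z \<mapsto> -1/z singles out the right cube root.\<close>
  have "eta_sq \<i> = \<kappa> * \<i> * eta_sq \<i>"
    using 1[of \<i>] by simp
  then have "\<kappa> * \<i> = 1"
    using eta_sq_nonzero[of \<i>] by simp
  then have "(\<kappa> * \<i>)\<^sup>2 = 1"
    by simp
  then have "- (\<kappa>\<^sup>2) = 1"
    by (simp add: power_mult_distrib)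
  then have "\<kappa>\<^sup>2 = - 1"
    by (metis minus_minus)
  with 1 that show ?thesis by blast
qed

subsection \<open>Modular transformations\<close>

text \<open>The entries are separate integer arguments, so that inductions over matrices become
  inductions over four integers.\<close>

definition mob :: "int \<Rightarrow> int \<Rightarrow> int \<Rightarrow> int \<Rightarrow> complex \<Rightarrow> complex" where
  "mob a b c d z = (of_int a * z + of_int b) / (of_int c * z + of_int d)"

lemma mob_denom_nonzero:
  assumes "Im z > 0" "c \<noteq> 0 \<or> d \<noteq> 0"
  shows "of_int c * z + of_int d \<noteq> (0 :: complex)"
proof
  assume eq: "of_int c * z + of_int d = 0"
  have "of_int c * Im z = 0"
    using arg_cong[OF eq, of Im] by simp
  with assms eq show False by auto
qed

lemma mob_denom_det_nonzero:
  assumes "Im z > 0" "a * d - b * c = (1 :: int)"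
  shows "of_int c * z + of_int d \<noteq> (0 :: complex)" "of_int a * z + of_int b \<noteq> (0 :: complex)"
  using assms by (intro mob_denom_nonzero; force)+

lemma Im_mob_pos:
  assumes "Im z > 0" "a * d - b * c = 1"
  shows "Im (mob a b c d z) > 0"
proof -
  define N where "N = of_int c * z + of_int d"
  have N: "N \<noteq> 0"
    unfolding N_def by (rule mob_denom_det_nonzero[OF assms])
  have "of_int a * of_int d - of_int b * of_int c = (1 :: real)"
    using assms(2) by (metis of_int_1 of_int_diff of_int_mult)
  then have "Im ((of_int a * z + of_int b) * cnj N) = Im z"
    unfolding N_def by (simp add: algebra_simps)
  moreover have "mob a b c d z = (of_int a * z + of_int b) * cnj N / of_real ((norm N)\<^sup>2)"
    unfolding mob_def N_def[symmetric] complex_norm_square using N by simp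
  ultimately have "Im (mob a b c d z) = Im z / (norm N)\<^sup>2"
    by (simp add: Im_divide_of_real)
  then show ?thesis
    using assms(1) N by simp
qed

lemma mob_T:
  assumes "Im z > 0" "a * d - b * c = 1"
  shows "mob (a + k * c) (b + k * d) c d z = mob a b c d z + of_int k"
  using mob_denom_det_nonzero[OF assms] by (simp add: mob_def field_simps)

lemma mob_S: "mob (- c) (- d) a b z = - 1 / mob a b c d z"
  by (simp add: mob_def minus_divide_left[symmetric] divide_simps)

section \<open>Generation by elementary matrices\<close>

lemma det_eq_1_cases:
  assumes "a * d - b * 0 = (1 :: int)"
  obtains "a = 1" "d = 1" | "a = - 1" "d = - 1"
  using assms by (auto simp: zmult_eq_1_iff)

text \<open>The Euclidean algorithm on the first column: \<open>T\<close> reduces \<open>a\<close>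
  modulo \<open>c\<close>, \<open>S\<close> exchanges the two entries up to sign.\<close>

lemma SL2Z_induct [consumes 1, case_names upper T S]:
  fixes a b c d :: int
  assumes "a * d - b * c = 1"
    and upper: "\<And>a b d. a * d = 1 \<Longrightarrow> P a b 0 d"
    and T: "\<And>a b c d k. a * d - b * c = 1 \<Longrightarrow> P a b c d \<Longrightarrow> P (a + k * c) (b + k * d) c d"
    and S: "\<And>a b c d. a * d - b * c = 1 \<Longrightarrow> P a b c d \<Longrightarrow> P (- c) (- d) a b"
  shows "P a b c d"
  using assms(1)
proof (induction "nat \<bar>c\<bar>" arbitrary: a b c d rule: less_induct)
  case less
  show ?case
  proof (cases "c = 0")
    case True
    then show ?thesis using upper less.prems by simp
  next
    case False
    define r where "r = a mod c"
    define k where "k = a div c"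
    have a: "a = r + k * c"
      by (simp add: r_def k_def)
    have r: "\<bar>r\<bar> < \<bar>c\<bar>"
      unfolding r_def using False by (rule abs_mod_less)
    define b' where "b' = b - k * d"
    have det: "c * (- b') - d * (- r) = 1"
      using less.prems by (simp add: a b'_def algebra_simps)
    \<comment> \<open>\<open>S\<close> leads from the rows (c, d), (-r, -b') to (r, b'), (c, d), and
      the lower left entry -r is smaller than \<open>c\<close> in absolute value.\<close>
    have "P c d (- r) (- b')"
      by (rule less.hyps) (use r det in auto)
    from S[OF det this] have "P r b' c d" by simp
    moreover have "r * d - b' * c = 1"
      using det by (simp add: algebra_simps)
    ultimately have "P (r + k * c) (b' + k * d) c d"
      by (intro T)
    then show ?thesis
      by (simp add: a b'_def)
  qed
qed

text \<open>Since \<open>a\<close> is odd and \<open>c\<close> even, \<bar>a\<bar> and \<bar>c\<bar>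
  differ. If \<bar>a\<bar> is larger, adding or subtracting \<open>c\<close> shrinks it; if
  \<bar>c\<bar> is larger, adding or subtracting 2a does. So \<bar>a\<bar> + \<bar>c\<bar> decreases
  until c = 0.\<close>

lemma Gamma0_2_induct [consumes 2, case_names upper T T' W W']:
  fixes a b c d :: int
  assumes "a * d - b * c = 1" "even c"
    and upper: "\<And>a b d. a * d = 1 \<Longrightarrow> P a b 0 d"
    and T: "\<And>a b c d. a * d - b * c = 1 \<Longrightarrow> even c \<Longrightarrow> P a b c d \<Longrightarrow> P (a + c) (b + d) c d"
    and T': "\<And>a b c d. a * d - b * c = 1 \<Longrightarrow> even c \<Longrightarrow> P a b c d \<Longrightarrow> P (a - c) (b - d) c d"
    and W: "\<And>a b c d. a * d - b * c = 1 \<Longrightarrow> even c \<Longrightarrow> P a b c d \<Longrightarrow> P a b (c + 2 * a) (d + 2 * b)"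
    and W': "\<And>a b c d. a * d - b * c = 1 \<Longrightarrow> even c \<Longrightarrow> P a b c d \<Longrightarrow> P a b (c - 2 * a) (d - 2 * b)"
  shows "P a b c d"
  using assms(1,2)
proof (induction "nat (\<bar>a\<bar> + \<bar>c\<bar>)" arbitrary: a b c d rule: less_induct)
  case less
  have "odd (a * d - b * c)"
    unfolding less.prems(1) by simp
  then have "odd a"
    using less.prems(2) by auto
  then have ne: "a \<noteq> 0" "\<bar>a\<bar> \<noteq> \<bar>c\<bar>"
    using less.prems(2) by (auto simp: abs_eq_iff')
  show ?case
  proof (cases "c = 0")
    case True
    then show ?thesis using upper less.prems by simp
  next
    case c: False
    have dets: "(a - c) * d - (b - d) * c = 1" "(a + c) * d - (b + d) * c = 1"
      "a * (d - 2 * b) - b * (c - 2 * a) = 1" "a * (d + 2 * b) - b * (c + 2 * a) = 1"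
      using less.prems(1) by (simp_all add: algebra_simps)
    show ?thesis
    proof (cases "\<bar>a\<bar> > \<bar>c\<bar>")
      case big: True
      show ?thesis
      proof (cases "\<bar>a - c\<bar> < \<bar>a\<bar>")
        case True
        have "P (a - c) (b - d) c d"
          by (rule less.hyps) (use True dets less.prems in auto)
        from T[OF dets(1) less.prems(2) this] show ?thesis by simp
      next
        case False
        have "P (a + c) (b + d) c d"
          by (rule less.hyps) (use False big c dets less.prems in auto)
        from T'[OF dets(2) less.prems(2) this] show ?thesis by simp
      qed
    next
      case small: False
      show ?thesis
      proof (cases "\<bar>c - 2 * a\<bar> < \<bar>c\<bar>")
        case True
        have "P a b (c - 2 * a) (d - 2 * b)"
          by (rule less.hyps) (use True dets less.prems in auto)
        from W[OF dets(3) _ this] show ?thesis using less.prems by simp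
      next
        case False
        have "P a b (c + 2 * a) (d + 2 * b)"
          by (rule less.hyps) (use False small ne c dets less.prems in auto)
        from W'[OF dets(4) _ this] show ?thesis using less.prems by simp
      qed
    qed
  qed
qed

section \<open>Transformation of \<open>eta_sq\<close> under the full modular group\<close>

lemma e2pi_of_int_mult: "e2pi (of_int n * z) = e2pi z powi n"
proof (cases "n \<ge> 0")
  case True
  then show ?thesis
    using e2pi_of_nat_mult[of "nat n" z] by (simp add: power_int_def)
next
  case False
  then have "e2pi (of_int n * z) = inverse (e2pi (of_nat (nat (- n)) * z))"
    by (simp add: e2pi_minus)
  then show ?thesis
    unfolding e2pi_of_nat_mult using False by (simp add: power_int_def power_inverse)
qed

lemma eta_sq_add_of_int: "eta_sq (z + of_int n) = e2pi (of_int n / 12) * eta_sq z"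
  by (simp add: eta_sq_def e2pi_add add_divide_distrib)

text \<open>The multiplier is left unspecified: for orders at the cusps only its being nonzero
  matters. Exact multipliers are determined later, for \<open>theta_sq\<close>.\<close>

lemma eta_sq_mob:
  assumes "a * d - b * c = 1"
  shows "\<exists>\<epsilon>\<noteq>0. \<forall>z. Im z > 0 \<longrightarrow> eta_sq (mob a b c d z) = \<epsilon> * (of_int c * z + of_int d) * eta_sq z"
  using assms
proof (induction rule: SL2Z_induct)
  case (upper a b d)
  then have "a * d - b * 0 = 1" by simp
  then show ?case
  proof (cases rule: det_eq_1_cases)
    case 1
    then show ?thesis
      by (intro exI[of _ "e2pi (of_int b / 12)"]) (simp add: mob_def eta_sq_add_of_int)
  next
    case 2
    \<comment> \<open>This map is translation by -b; its denominator -1 accounts for the sign in the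
      witness below.\<close>
    have "eta_sq (mob (- 1) b 0 (- 1) z) = e2pi (of_int (- b) / 12) * eta_sq z" for z
      using eta_sq_add_of_int[of z "- b"] by (simp add: mob_def)
    with 2 show ?thesis
      by (intro exI[of _ "- e2pi (of_int (- b) / 12)"]) simp
  qed
next
  case (T a b c d k)
  then obtain \<epsilon> where "\<epsilon> \<noteq> 0"
    "\<And>z. Im z > 0 \<Longrightarrow> eta_sq (mob a b c d z) = \<epsilon> * (of_int c * z + of_int d) * eta_sq z"
    by blast
  then show ?case
    using T.hyps by (intro exI[of _ "e2pi (of_int k / 12) * \<epsilon>"]) (simp add: mob_T eta_sq_add_of_int)
next
  case (S a b c d)
  then obtain \<epsilon> where \<epsilon>: "\<epsilon> \<noteq> 0"
    "\<And>z. Im z > 0 \<Longrightarrow> eta_sq (mob a b c d z) = \<epsilon> * (of_int c * z + of_int d) * eta_sq z"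
    by blast
  obtain \<kappa> where \<kappa>: "\<And>z. Im z > 0 \<Longrightarrow> eta_sq (- 1 / z) = \<kappa> * z * eta_sq z" "\<kappa>\<^sup>2 = - 1"
    using eta_sq_inversion by blast
  have "eta_sq (mob (- c) (- d) a b z) = (\<kappa> * \<epsilon>) * (of_int a * z + of_int b) * eta_sq z"
    if z: "Im z > 0" for z
    unfolding mob_S
    using \<kappa>(1)[OF Im_mob_pos[OF z S.hyps]] \<epsilon>(2)[OF z] mob_denom_det_nonzero[OF z S.hyps]
    by (simp add: mob_def)
  moreover have "\<kappa> * \<epsilon> \<noteq> 0"
    using \<kappa>(2) \<epsilon>(1) by auto
  ultimately show ?case
    by blast
qed

text \<open>Writes \<open>diag(\<delta>, 1)\<close> times the given matrix as a unimodular matrix times an upper triangular one.\<close>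
lemma eta_sq_mult_mob:
  fixes \<delta> :: int
  assumes det: "a * d - b * c = 1" and "\<delta> > 0"
  obtains B :: int and \<kappa> :: complex where "\<kappa> \<noteq> 0"
    "\<And>z. Im z > 0 \<Longrightarrow> eta_sq (of_int \<delta> * mob a b c d z) =
       \<kappa> * (of_int c * z + of_int d) *
       eta_sq ((of_int (gcd \<delta> c) * z + of_int B) / of_int (\<delta> div gcd \<delta> c))"
proof -
  define g where "g = gcd \<delta> c"
  define D where "D = \<delta> div g"
  define s where "s = c div g"
  have g: "g > 0" using \<open>\<delta> > 0\<close> by (simp add: g_def)
  have \<delta>: "\<delta> = D * g" and c: "c = s * g"
    by (simp_all add: D_def s_def g_def)
  have "D > 0" using \<open>\<delta> > 0\<close> g by (simp add: \<delta> zero_less_mult_iff)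
  have "coprime D s"
    unfolding D_def s_def g_def using \<open>\<delta> > 0\<close> by (intro div_gcd_coprime) auto
  \<comment> \<open>Multiplying a Bezout relation for \<open>s\<close> and \<open>D\<close> by
    \<open>d\<close> solves s B + u D = d, the lower right entry of the factorization.\<close>
  then obtain x y where "x * s + y * D = 1"
    using bezout_int[of s D] by (auto simp: coprime_iff_gcd_eq_1 gcd.commute)
  then have "(d * x) * s + (d * y) * D = d"
    by (metis distrib_left mult.assoc mult.right_neutral)
  then obtain B u where Bu: "s * B + u * D = d"
    by (metis mult.commute)
  \<comment> \<open>The matrix with rows (\<delta> a, \<delta> b), (c, d) equals the one with rows
    (p, r), (s, u) times the one with rows (g, B), (0, D). The upper row forces \<open>p\<close> and
    \<open>r\<close>.\<close>
  define p where "p = D * a"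
  define r where "r = g * b - a * B"
  have det': "p * u - r * s = 1"
  proof -
    have "p * u - r * s = a * (s * B + u * D) - b * c"
      by (simp add: p_def r_def c algebra_simps)
    then show ?thesis using det Bu by simp
  qed
  obtain \<epsilon> where \<epsilon>: "\<epsilon> \<noteq> 0"
    "\<And>z. Im z > 0 \<Longrightarrow> eta_sq (mob p r s u z) = \<epsilon> * (of_int s * z + of_int u) * eta_sq z"
    using eta_sq_mob[OF det'] by blast
  show ?thesis
  proof (rule that)
    show "\<epsilon> / of_int D \<noteq> 0" using \<epsilon>(1) \<open>D > 0\<close> by simp
    fix z :: complex assume z: "Im z > 0"
    define w where "w = (of_int g * z + of_int B) / (of_int D :: complex)"
    have w: "Im w > 0"
      using z g \<open>D > 0\<close> Im_divide_of_real[of "of_int g * z + of_int B" "of_int D"] by (simp add: w_def)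
    have D0: "of_int D \<noteq> (0 :: complex)" using \<open>D > 0\<close> by simp
    have 1: "of_int s * w + of_int u = (of_int c * z + of_int d) / (of_int D :: complex)"
      using D0 by (simp add: w_def c Bu[symmetric] field_simps)
    have 2: "of_int p * w + of_int r = of_int g * (of_int a * z + of_int b)"
      using D0 by (simp add: w_def p_def r_def field_simps)
    have "mob p r s u w = of_int \<delta> * mob a b c d z"
      unfolding mob_def 1 2 using D0 mob_denom_det_nonzero[OF z det] by (simp add: \<delta> field_simps)
    then have "eta_sq (of_int \<delta> * mob a b c d z) =
        \<epsilon> * ((of_int c * z + of_int d) / of_int D) * eta_sq w"
      using \<epsilon>(2)[OF w] 1 by simp
    then show "eta_sq (of_int \<delta> * mob a b c d z) =
        \<epsilon> / of_int D * (of_int c * z + of_int d) *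
       eta_sq ((of_int (gcd \<delta> c) * z + of_int B) / of_int (\<delta> div gcd \<delta> c))"
      by (simp add: w_def D_def g_def)
  qed
qed

text \<open>Up to a factor \<open>4\<close>, this is the square of the theta constant \<open>\<theta>\<^sub>2\<close>.\<close>
definition theta_sq :: "complex \<Rightarrow> complex" where
  "theta_sq z = eta_sq (2 * z) ^ 2 / eta_sq z"

section \<open>The character of the squared theta constant on matrices with even lower left
  entry\<close>

lemma theta_sq_add_of_int: "theta_sq (z + of_int n) = \<i> powi n * theta_sq z"
proof -
  define x :: complex where "x = of_int (2 * n) / 12"
  have "eta_sq (2 * (z + of_int n)) = e2pi x * eta_sq (2 * z)"
    using eta_sq_add_of_int[of "2 * z" "2 * n"] by (simp add: x_def ring_distribs)
  then have "theta_sq (z + of_int n) = e2pi (2 * x - of_int n / 12) * theta_sq z"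
    using eta_sq_add_of_int[of z n]
    by (simp add: theta_sq_def e2pi_diff e2pi_numeral_mult power_mult_distrib)
  also have "2 * x - of_int n / 12 = of_int n * (1 / 4)"
    by (simp add: x_def field_simps)
  finally show ?thesis
    by (simp only: e2pi_of_int_mult e2pi_quarter)
qed

text \<open>z / (z + 1) arises from inversion, translation by -1 and inversion again. The constant
  of the inversion formula enters only through its square -1, so the multiplier is explicit.\<close>

lemma eta_sq_W:
  assumes z: "Im z > 0"
  shows "eta_sq (z / (z + 1)) = e2pi (- 1 / 12) * (z + 1) * eta_sq z"
proof -
  obtain \<kappa> where \<kappa>: "\<And>z. Im z > 0 \<Longrightarrow> eta_sq (- 1 / z) = \<kappa> * z * eta_sq z" "\<kappa>\<^sup>2 = - 1"
    using eta_sq_inversion by blast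
  have z0: "z \<noteq> 0" "z + 1 \<noteq> 0" "- 1 \<noteq> z"
    using z by (auto simp: complex_eq_iff)
  define w where "w = - 1 / z + of_int (- 1)"
  have w: "Im w > 0"
    using Im_uminus_inverse_pos[OF z] by (simp add: w_def)
  have "z / (z + 1) = - 1 / w"
    using z0 by (simp add: w_def divide_simps) (simp add: algebra_simps)
  then have "eta_sq (z / (z + 1)) = \<kappa> * w * (e2pi (of_int (- 1) / 12) * (\<kappa> * z * eta_sq z))"
    using \<kappa>(1)[OF w] \<kappa>(1)[OF z] eta_sq_add_of_int[of "- 1 / z" "- 1"] by (simp only: w_def)
  also have "\<dots> = \<kappa>\<^sup>2 * (w * z) * e2pi (- 1 / 12) * eta_sq z"
    by (simp add: power2_eq_square)
  also have "w * z = - (z + 1)"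
    using z0 by (simp add: w_def field_simps)
  finally show ?thesis
    using \<kappa>(2) by simp
qed

text \<open>The map is z \<mapsto> z / (z + 1) applied twice to \<open>z\<close>, but only once to
  2z. As \<open>eta_sq (2 * z)\<close> occurs squared in \<open>theta_sq\<close>, the roots of unity
  cancel.\<close>

lemma theta_sq_W:
  assumes z: "Im z > 0"
  shows "theta_sq (z / (2 * z + 1)) = (2 * z + 1) * theta_sq z"
proof -
  have z1: "Im (z / (z + 1)) > 0"
    using Im_mob_pos[OF z, of 1 1 0 1] by (simp add: mob_def)
  have nz: "z + 1 \<noteq> 0" "2 * z + 1 \<noteq> 0"
    using z by (auto simp: complex_eq_iff)
  have sum: "z / (z + 1) + 1 = (2 * z + 1) / (z + 1)"
    using nz by (simp add: field_simps)
  then have "z / (2 * z + 1) = (z / (z + 1)) / (z / (z + 1) + 1)"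
    using nz by simp
  then have "eta_sq (z / (2 * z + 1)) =
      e2pi (- 1 / 12) * (z / (z + 1) + 1) * (e2pi (- 1 / 12) * (z + 1) * eta_sq z)"
    using eta_sq_W[OF z1] eta_sq_W[OF z] by (simp only:)
  also have "\<dots> = e2pi (- 1 / 12) ^ 2 * ((z / (z + 1) + 1) * (z + 1)) * eta_sq z"
    by (simp add: power2_eq_square)
  also have "(z / (z + 1) + 1) * (z + 1) = 2 * z + 1"
    unfolding sum using nz by simp
  finally have 1: "eta_sq (z / (2 * z + 1)) = e2pi (- 1 / 12) ^ 2 * (2 * z + 1) * eta_sq z" .
  have "eta_sq (2 * (z / (2 * z + 1))) = e2pi (- 1 / 12) * (2 * z + 1) * eta_sq (2 * z)"
    using eta_sq_W[of "2 * z"] z by simp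
  with 1 show ?thesis
    using nz by (simp add: theta_sq_def power_mult_distrib) (simp add: power2_eq_square)
qed

lemma theta_sq_W':
  assumes z: "Im z > 0"
  shows "theta_sq (z / (1 - 2 * z)) = (1 - 2 * z) * theta_sq z"
proof -
  have nz: "1 - 2 * z \<noteq> 0"
    using z by (auto simp: complex_eq_iff)
  define w where "w = z / (1 - 2 * z)"
  have w: "Im w > 0"
    using Im_mob_pos[OF z, of 1 1 0 "- 2"] by (simp add: mob_def w_def)
  have 1: "2 * w + 1 = 1 / (1 - 2 * z)"
    using nz by (simp add: w_def field_simps)
  have "w / (2 * w + 1) = z"
    unfolding 1 using nz by (simp add: w_def)
  then have "theta_sq z = 1 / (1 - 2 * z) * theta_sq w"
    using theta_sq_W[OF w] unfolding 1 by simp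
  then show ?thesis
    using nz by (simp add: w_def[symmetric])
qed

lemma i_powi_add_4: "\<i> powi (n + 4 * k) = \<i> powi n"
proof -
  have "\<i> powi (4 * k) = (\<i> powi 4) powi k"
    by (rule power_int_mult)
  also have "\<i> powi 4 = 1" by simp
  finally show ?thesis
    by (simp add: power_int_add)
qed

text \<open>The closed form of the multiplier is checked on generators. Translation by 1 adds d^2 to
  the exponent, which is 1 modulo 4 for odd \<open>d\<close>; the lower triangular generator adds
  2b(b + 1), which is 0 modulo 4.\<close>

lemma theta_sq_mob:
  assumes "a * d - b * c = 1" "even c" "Im z > 0"
  shows "theta_sq (mob a b c d z) =
    \<i> powi ((b + 1) * d - 1) * (of_int c * z + of_int d) * theta_sq z"
proof -
  have T: "\<i> powi ((b + d + 1) * d - 1) = \<i> * \<i> powi ((b + 1) * d - 1)" if d: "odd d" for b d :: int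
  proof -
    obtain j where j: "d = 2 * j + 1" using d by (rule oddE)
    have "(b + d + 1) * d - 1 = (1 + ((b + 1) * d - 1)) + 4 * (j * j + j)"
      by (simp add: j algebra_simps)
    then show ?thesis
      by (simp only: i_powi_add_4) (subst power_int_add; simp)
  qed
  have W: "\<i> powi ((b + 1) * (d + 2 * b) - 1) = \<i> powi ((b + 1) * d - 1)" for b d :: int
  proof -
    have "even (b * (b + 1))" by simp
    then obtain j where "b * (b + 1) = 2 * j" by blast
    then have "(b + 1) * (d + 2 * b) - 1 = ((b + 1) * d - 1) + 4 * j"
      by (simp add: algebra_simps)
    then show ?thesis
      by (simp only: i_powi_add_4)
  qed
  have odd_d: "odd d" if "a * d - b * c = 1" "even c" for a b c d :: int
  proof
    assume "even d"
    then have "even (a * d - b * c)" using that(2) by simp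
    then show False unfolding that(1) by simp
  qed
  show ?thesis
    using assms
  proof (induction rule: Gamma0_2_induct)
    case (upper a b d)
    then have "a * d - b * 0 = 1" by simp
    then show ?case
    proof (cases rule: det_eq_1_cases)
      case 1
      then show ?thesis
        by (simp add: mob_def theta_sq_add_of_int)
    next
      case 2
      have "theta_sq (mob (- 1) b 0 (- 1) z) = \<i> powi (- b) * theta_sq z"
        using theta_sq_add_of_int[of z "- b"] by (simp add: mob_def)
      \<comment> \<open>The sign compensates for the denominator -1.\<close>
      moreover have "\<i> powi (- 2 - b) = - (\<i> powi (- b))"
        by (simp add: power_int_diff power_int_minus field_simps)
      ultimately show ?thesis
        unfolding 2 by simp
    qed
  next
    case (T a b c d)
    have "theta_sq (mob (a + c) (b + d) c d z) = \<i> * theta_sq (mob a b c d z)"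
      using mob_T[OF T.prems T.hyps(1), of 1] theta_sq_add_of_int[of "mob a b c d z" 1] by simp
    then show ?case
      using T.IH[OF T.prems] \<open>\<And>b d. odd d \<Longrightarrow> \<i> powi ((b + d + 1) * d - 1) = _\<close>[OF odd_d[OF T.hyps(1,2)]]
      by simp
  next
    case (T' a b c d)
    have 1: "\<i> powi ((b + 1) * d - 1) = \<i> * \<i> powi ((b - d + 1) * d - 1)"
      using T[OF odd_d[OF T'.hyps(1,2)], of "b - d"] by simp
    have "theta_sq (mob (a - c) (b - d) c d z) = \<i> powi (- 1) * theta_sq (mob a b c d z)"
      using mob_T[OF T'.prems T'.hyps(1), of "- 1"] theta_sq_add_of_int[of "mob a b c d z" "- 1"] by simp
    then show ?case
      using T'.IH[OF T'.prems] unfolding 1 by (simp add: power_int_minus mult.assoc)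
  next
    case (W a b c d)
    define w where "w = mob a b c d z"
    have w: "Im w > 0"
      unfolding w_def by (rule Im_mob_pos[OF W.prems W.hyps(1)])
    note nz = mob_denom_det_nonzero[OF W.prems W.hyps(1)]
    have den: "2 * w + 1 = (of_int (c + 2 * a) * z + of_int (d + 2 * b)) / (of_int c * z + of_int d)"
      using nz by (simp add: w_def mob_def field_simps)
    then have "mob a b (c + 2 * a) (d + 2 * b) z = w / (2 * w + 1)"
      unfolding den using nz by (simp add: w_def mob_def)
    then have "theta_sq (mob a b (c + 2 * a) (d + 2 * b) z) = (2 * w + 1) * theta_sq w"
      using theta_sq_W[OF w] by simp
    then show ?case
      unfolding den using W.IH[OF W.prems] nz
      by (simp add: w_def \<open>\<And>b d. \<i> powi ((b + 1) * (d + 2 * b) - 1) = _\<close>)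
  next
    case (W' a b c d)
    define w where "w = mob a b c d z"
    have w: "Im w > 0"
      unfolding w_def by (rule Im_mob_pos[OF W'.prems W'.hyps(1)])
    note nz = mob_denom_det_nonzero[OF W'.prems W'.hyps(1)]
    have 1: "\<i> powi ((b + 1) * (d - 2 * b) - 1) = \<i> powi ((b + 1) * d - 1)"
      using W[of b "d - 2 * b"] by simp
    have den: "1 - 2 * w = (of_int (c - 2 * a) * z + of_int (d - 2 * b)) / (of_int c * z + of_int d)"
      using nz by (simp add: w_def mob_def field_simps)
    then have "mob a b (c - 2 * a) (d - 2 * b) z = w / (1 - 2 * w)"
      unfolding den using nz by (simp add: w_def mob_def)
    then have "theta_sq (mob a b (c - 2 * a) (d - 2 * b) z) = (1 - 2 * w) * theta_sq w"
      using theta_sq_W'[OF w] by simp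
    then show ?case
      unfolding den using W'.IH[OF W'.prems] nz by (simp add: w_def 1)
  qed
qed

subsection \<open>A Hauptmodul of level 10\<close>

definition hauptmodul :: "complex \<Rightarrow> complex" where
  "hauptmodul z = theta_sq z / theta_sq (5 * z)"

lemma hauptmodul_eta_sq:
  "hauptmodul z = eta_sq (2 * z) ^ 2 * eta_sq (5 * z) / (eta_sq z * eta_sq (10 * z) ^ 2)"
  by (simp add: hauptmodul_def theta_sq_def)

lemma holomorphic_hauptmodul: "hauptmodul holomorphic_on {z. Im z > 0}"
proof -
  have *: "(\<lambda>z. eta_sq (of_nat k * z)) holomorphic_on {z. Im z > 0}" if "k > 0" for k
  proof -
    have "(eta_sq \<circ> (\<lambda>z. of_nat k * z)) holomorphic_on {z. Im z > 0}"
      by (rule holomorphic_on_compose_gen[OF _ holomorphic_eta_sq])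
        (use that in \<open>auto intro!: holomorphic_intros\<close>)
    then show ?thesis by (simp add: o_def)
  qed
  show ?thesis
    unfolding hauptmodul_eta_sq[abs_def]
    using *[of 1] *[of 2] *[of 5] *[of 10]
    by (intro holomorphic_intros) (auto simp: eta_sq_nonzero)
qed

text \<open>Multiplication by 5 conjugates the matrix to one with entries 5b and c/5, still even
  below. The automorphy factors at \<open>z\<close> and 5z agree, and the exponents of i differ by
  4bd.\<close>

lemma hauptmodul_mob:
  assumes det: "a * d - b * c = 1" and c: "10 dvd c" and z: "Im z > 0"
  shows "hauptmodul (mob a b c d z) = hauptmodul z"
proof -
  obtain c' where c': "c = 10 * c'" using c by blast
  have det5: "a * d - (5 * b) * (2 * c') = 1"
    using det by (simp add: c')
  have z5: "Im (5 * z) > 0" using z by simp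
  have "5 * mob a b c d z = mob a (5 * b) (2 * c') d (5 * z)"
    by (simp add: mob_def c' field_simps)
  then have "theta_sq (5 * mob a b c d z) = \<i> powi ((5 * b + 1) * d - 1) *
      (of_int (2 * c') * (5 * z) + of_int d) * theta_sq (5 * z)"
    using theta_sq_mob[OF det5 _ z5] by simp
  also have "(5 * b + 1) * d - 1 = ((b + 1) * d - 1) + 4 * (b * d)"
    by (simp add: algebra_simps)
  also have "of_int (2 * c') * (5 * z) = of_int c * z"
    by (simp add: c')
  finally have "theta_sq (5 * mob a b c d z) =
      \<i> powi ((b + 1) * d - 1) * (of_int c * z + of_int d) * theta_sq (5 * z)"
    by (simp only: i_powi_add_4)
  moreover have "even c" by (simp add: c')
  ultimately show ?thesis
    using theta_sq_mob[OF det _ z] mob_denom_det_nonzero(1)[OF z det]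
    by (simp add: hauptmodul_def)
qed

text \<open>All expansions at the cusps are taken in powers of \<open>exp (2 \<pi> i z / 120)\<close>, which makes the
  exponents of all eta factors integral.\<close>
lemma eta_sq_at_cusp:
  fixes \<delta> :: int
  assumes det: "a * d - b * c = 1" and \<delta>: "\<delta> > 0" "\<delta> dvd 10"
  obtains G where "G holomorphic_on ball 0 1" "\<And>x. norm x < 1 \<Longrightarrow> G x \<noteq> 0"
    "\<And>z. Im z > 0 \<Longrightarrow> eta_sq (of_int \<delta> * mob a b c d z) =
       (of_int c * z + of_int d) * e2pi (z / 120) powi (10 * gcd \<delta> c div (\<delta> div gcd \<delta> c)) *
       G (e2pi (z / 120))"
proof -
  define g where "g = gcd \<delta> c"
  define D where "D = \<delta> div g"
  have g: "g > 0" using \<delta>(1) by (simp add: g_def)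
  have \<delta>_eq: "\<delta> = D * g" by (simp add: D_def g_def)
  have D: "D > 0" using \<delta>(1) g by (simp add: \<delta>_eq zero_less_mult_iff)
  have "D dvd 10"
    using \<delta>(2) by (rule dvd_trans[rotated]) (simp add: \<delta>_eq)
  \<comment> \<open>That \<open>D\<close> divides 10 makes the exponents in powers of e2pi (z / 120)
    integral.\<close>
  then obtain e where e: "10 = D * e" ..
  have e0: "e > 0" using e D by (metis zero_less_mult_pos zero_less_numeral)
  \<comment> \<open>In terms of x = e2pi (z / 120), the argument (g z + B) / D is 12 k (z / 120) +
    \<beta>. Thus \<open>eta_sq\<close> has order \<open>k\<close> in x, and its Euler product is a
    power series in x^(12k).\<close>
  define k where "k = e * g"
  define l where "l = nat (12 * k)"
  have l: "l > 0" using e0 g by (simp add: l_def k_def)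
  obtain B \<kappa> where \<kappa>: "\<kappa> \<noteq> 0" and H: "\<And>z. Im z > 0 \<Longrightarrow>
      eta_sq (of_int \<delta> * mob a b c d z) = \<kappa> * (of_int c * z + of_int d) *
        eta_sq ((of_int g * z + of_int B) / of_int D)"
    using eta_sq_mult_mob[OF det \<delta>(1)] unfolding g_def D_def by blast
  define \<beta> :: complex where "\<beta> = of_int B / of_int D"
  have norm_\<beta>: "norm (e2pi \<beta>) = 1"
    by (simp add: norm_e2pi \<beta>_def)
  define G where "G x = \<kappa> * e2pi (\<beta> / 12) * euler_fun (e2pi \<beta> * x ^ l) ^ 2" for x
  have small: "norm (e2pi \<beta> * x ^ l) < 1" if "norm x < 1" for x :: complex
    using that l by (simp add: norm_mult norm_\<beta> norm_power power_less_one_iff)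
  have k_eq: "10 * g div D = k"
    unfolding e k_def using D by simp
  show ?thesis
  proof (rule that)
    have "(euler_fun \<circ> (\<lambda>x. e2pi \<beta> * x ^ l)) holomorphic_on ball 0 1"
      by (rule holomorphic_on_compose_gen[OF _ holomorphic_euler_fun])
        (use small in \<open>auto intro!: holomorphic_intros\<close>)
    then show "G holomorphic_on ball 0 1"
      unfolding G_def[abs_def] by (intro holomorphic_intros) (simp_all add: o_def)
    show "G x \<noteq> 0" if "norm x < 1" for x
      using euler_fun_nonzero[OF small[OF that]] \<kappa> by (simp add: G_def)
    fix z :: complex assume z: "Im z > 0"
    have eD: "of_int D * of_int e = (10 :: complex)"
      using e by (metis of_int_mult of_int_numeral)
    have D0: "of_int D \<noteq> (0 :: complex)" using D by simp
    have w: "(of_int g * z + of_int B) / of_int D = of_int (12 * k) * (z / 120) + \<beta>"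
      using D0 eD by (simp add: \<beta>_def k_def field_simps)
    have w12: "(of_int (12 * k) * (z / 120) + \<beta>) / 12 = of_int k * (z / 120) + \<beta> / 12"
      by (simp add: field_simps)
    have pw: "e2pi (z / 120) powi (12 * k) = e2pi (z / 120) ^ l"
      unfolding l_def power_int_def using e0 g by (simp add: k_def)
    have "eta_sq ((of_int g * z + of_int B) / of_int D) =
        e2pi (z / 120) powi k * e2pi (\<beta> / 12) * euler_fun (e2pi \<beta> * e2pi (z / 120) ^ l) ^ 2"
      unfolding eta_sq_def w w12 e2pi_add e2pi_of_int_mult pw by (simp only: mult_ac)
    then show "eta_sq (of_int \<delta> * mob a b c d z) = (of_int c * z + of_int d) *
        e2pi (z / 120) powi (10 * gcd \<delta> c div (\<delta> div gcd \<delta> c)) * G (e2pi (z / 120))"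
      using H[OF z] k_eq by (simp add: G_def g_def[symmetric] D_def[symmetric])
  qed
qed

text \<open>The left side is the order of \<open>hauptmodul\<close> in e2pi (z / 120) at a cusp with
  denominator \<open>c\<close>. It equals 0, 24, 0 for gcd (10, c) = 1, 2, 5.\<close>

lemma cusp_order_hauptmodul:
  fixes c :: int
  assumes "\<not> 10 dvd c"
  shows "2 * (10 * gcd 2 c div (2 div gcd 2 c)) + 10 * gcd 5 c div (5 div gcd 5 c) - 10 -
    2 * (10 * gcd 10 c div (10 div gcd 10 c)) \<ge> 0"
proof -
  have 2: "gcd 2 c = (if even c then 2 else 1)"
    by (auto simp: gcd_proj1_iff coprime_iff_gcd_eq_1[symmetric])
  have 5: "gcd 5 c = (if 5 dvd c then 5 else 1)"
    using prime_imp_coprime[of 5 c] by (auto simp: gcd_proj1_iff coprime_iff_gcd_eq_1[symmetric])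
  have not_both: "\<not> (even c \<and> 5 dvd c)"
    using assms divides_mult[of 2 c 5] by auto
  have 10: "gcd 10 c = (if even c then 2 else if 5 dvd c then 5 else 1)"
  proof -
    consider e where "c = 2 * e" | e where "c = 5 * e" "odd c" | "odd c" "\<not> 5 dvd c"
      by (metis dvdE)
    then show ?thesis
    proof cases
      case 1
      then have "\<not> 5 dvd e" using not_both by auto
      then have "gcd 5 e = 1" using prime_imp_coprime[of 5 e] by (simp add: coprime_iff_gcd_eq_1)
      then show ?thesis using gcd_mult_distrib_int[of 2 5 e] 1 by simp
    next
      case 2
      then have "gcd 2 e = 1" by (auto simp: coprime_iff_gcd_eq_1[symmetric])
      then show ?thesis using gcd_mult_distrib_int[of 5 2 e] 2 by simp
    next
      case 3
      then have "coprime (2 * 5) c"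
        using prime_imp_coprime[of 5 c] by (simp only: coprime_mult_left_iff) auto
      then show ?thesis using 3 by (simp add: coprime_iff_gcd_eq_1)
    qed
  qed
  show ?thesis
    unfolding 10 2 5 using not_both by auto
qed

text \<open>Numerator and denominator of the eta quotient carry the factor c z + d three times each.
  What remains is a power of e2pi (z / 120) times a function holomorphic on the unit disc.\<close>

lemma hauptmodul_at_cusp:
  assumes det: "a * d - b * c = 1"
  obtains F where "has_q_expansion 120 (\<lambda>z. hauptmodul (mob a b c d z)) F"
    "\<not> 10 dvd c \<Longrightarrow> \<forall>n<0. fls_nth F n = 0"
proof -
  define k where "k \<delta> = 10 * gcd \<delta> c div (\<delta> div gcd \<delta> c)" for \<delta> :: int
  note cusp = eta_sq_at_cusp[OF det, folded k_def]
  obtain G1 where G1: "G1 holomorphic_on ball 0 1" "\<And>x. norm x < 1 \<Longrightarrow> G1 x \<noteq> 0"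
    "\<And>z. Im z > 0 \<Longrightarrow> eta_sq (of_int 1 * mob a b c d z) =
      (of_int c * z + of_int d) * e2pi (z / 120) powi (k 1) * G1 (e2pi (z / 120))"
    by (rule cusp[of 1]) auto
  obtain G2 where G2: "G2 holomorphic_on ball 0 1" "\<And>x. norm x < 1 \<Longrightarrow> G2 x \<noteq> 0"
    "\<And>z. Im z > 0 \<Longrightarrow> eta_sq (of_int 2 * mob a b c d z) =
      (of_int c * z + of_int d) * e2pi (z / 120) powi (k 2) * G2 (e2pi (z / 120))"
    by (rule cusp[of 2]) auto
  obtain G5 where G5: "G5 holomorphic_on ball 0 1" "\<And>x. norm x < 1 \<Longrightarrow> G5 x \<noteq> 0"
    "\<And>z. Im z > 0 \<Longrightarrow> eta_sq (of_int 5 * mob a b c d z) =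
      (of_int c * z + of_int d) * e2pi (z / 120) powi (k 5) * G5 (e2pi (z / 120))"
    by (rule cusp[of 5]) auto
  obtain G10 where G10: "G10 holomorphic_on ball 0 1" "\<And>x. norm x < 1 \<Longrightarrow> G10 x \<noteq> 0"
    "\<And>z. Im z > 0 \<Longrightarrow> eta_sq (of_int 10 * mob a b c d z) =
      (of_int c * z + of_int d) * e2pi (z / 120) powi (k 10) * G10 (e2pi (z / 120))"
    by (rule cusp[of 10]) auto
  define N where "N = 2 * k 2 + k 5 - k 1 - 2 * k 10"
  define G where "G x = G2 x ^ 2 * G5 x / (G1 x * G10 x ^ 2)" for x
  have "G holomorphic_on ball 0 1"
    unfolding G_def[abs_def] using G1(2) G10(2)
    by (intro holomorphic_intros G1(1) G2(1) G5(1) G10(1)) auto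
  then have "G has_fps_expansion fps_expansion G 0"
    by (intro has_fps_expansion_fps_expansion[of "ball 0 1"]) auto
  then have lau: "(\<lambda>x. x powi N * G x) has_laurent_expansion
      fls_X_intpow N * fps_to_fls (fps_expansion G 0)"
    by (intro laurent_expansion_intros has_laurent_expansion_fps)
  have eq: "hauptmodul (mob a b c d z) = e2pi (z / 120) powi N * G (e2pi (z / 120))"
    if z: "Im z > 0" for z
  proof -
    define Q where "Q = e2pi (z / 120)"
    define j where "j = of_int c * z + (of_int d :: complex)"
    have j: "j \<noteq> 0"
      unfolding j_def using mob_denom_det_nonzero[OF z det] by simp
    have Q: "Q \<noteq> 0" by (simp add: Q_def)
    have "hauptmodul (mob a b c d z) = (j * Q powi k 2 * G2 Q) ^ 2 * (j * Q powi k 5 * G5 Q) /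
        ((j * Q powi k 1 * G1 Q) * (j * Q powi k 10 * G10 Q) ^ 2)"
      using G1(3)[OF z] G2(3)[OF z] G5(3)[OF z] G10(3)[OF z]
      by (simp add: hauptmodul_eta_sq Q_def j_def)
    also have "\<dots> = (Q powi k 2) ^ 2 * Q powi k 5 / (Q powi k 1 * (Q powi k 10) ^ 2) * G Q"
      using j by (simp add: G_def power_mult_distrib power2_eq_square mult_ac)
    also have "(Q powi k 2) ^ 2 * Q powi k 5 / (Q powi k 1 * (Q powi k 10) ^ 2) = Q powi N"
    proof -
      have "N = k 2 + k 2 + k 5 - (k 1 + (k 10 + k 10))"
        by (simp add: N_def)
      then show ?thesis
        using Q by (simp only: power_int_diff power_int_add power2_eq_square not_False_eq_True simp_thms)
    qed
    finally show ?thesis by (simp add: Q_def)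
  qed
  show ?thesis
  proof (rule that)
    show "has_q_expansion 120 (\<lambda>z. hauptmodul (mob a b c d z))
        (fls_X_intpow N * fps_to_fls (fps_expansion G 0))"
      unfolding has_q_expansion_def upper_half_plane_def
      by (rule exI, rule conjI[OF lau]) (auto simp: eq e2pi_def)
    assume "\<not> 10 dvd c"
    from cusp_order_hauptmodul[OF this] have "N \<ge> 0"
      by (simp add: N_def k_def)
    then show "\<forall>n<0. fls_nth (fls_X_intpow N * fps_to_fls (fps_expansion G 0)) n = 0"
      by (auto simp: fls_X_intpow_times_conv_shift)
  qed
qed

subsection \<open>Integrality\<close>

definition integral_fps :: "complex fps \<Rightarrow> bool" where
  "integral_fps F \<longleftrightarrow> (\<forall>n. fps_nth F n \<in> \<int>)"

lemma integral_fps_mult: "integral_fps F \<Longrightarrow> integral_fps G \<Longrightarrow> integral_fps (F * G)"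
  unfolding integral_fps_def fps_mult_nth by (auto intro!: Ints_sum Ints_mult)

lemma integral_fps_1: "integral_fps 1"
  by (simp add: integral_fps_def)

lemma integral_fps_power: "integral_fps F \<Longrightarrow> integral_fps (F ^ n)"
  by (induction n) (auto intro: integral_fps_mult integral_fps_1)

lemma integral_fps_prod: "(\<And>i. i \<in> A \<Longrightarrow> integral_fps (F i)) \<Longrightarrow> integral_fps (\<Prod>i\<in>A. F i)"
  by (induction A rule: infinite_finite_induct) (auto intro: integral_fps_mult integral_fps_1)

lemma integral_fps_X_power: "integral_fps (fps_X ^ k)"
  by (auto simp: integral_fps_def)

lemma integral_fps_compose:
  "integral_fps F \<Longrightarrow> integral_fps G \<Longrightarrow> integral_fps (fps_compose F G)"
  using integral_fps_power[of G]
  unfolding integral_fps_def fps_compose_nth by (auto intro!: Ints_sum Ints_mult)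

text \<open>With constant term 1 the recursion for the coefficients of the inverse involves no
  division.\<close>

lemma integral_fps_inverse:
  assumes F: "integral_fps F" "fps_nth F 0 = 1"
  shows "integral_fps (inverse F)"
  unfolding integral_fps_def
proof
  fix n
  show "fps_nth (inverse F) n \<in> \<int>"
  proof (induction n rule: less_induct)
    case (less n)
    show ?case
    proof (cases "n = 0")
      case False
      have "F * inverse F = 1"
        using F(2) by (metis inverse_mult_eq_1' zero_neq_one)
      then have "(\<Sum>i=0..n. fps_nth F i * fps_nth (inverse F) (n - i)) = 0"
        using False by (simp add: fps_mult_nth[symmetric])
      then have "fps_nth (inverse F) n = - (\<Sum>i=1..n. fps_nth F i * fps_nth (inverse F) (n - i))"
        using F(2) by (simp add: sum.atLeast_Suc_atMost eq_neg_iff_add_eq_0)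
      moreover have "(\<Sum>i=1..n. fps_nth F i * fps_nth (inverse F) (n - i)) \<in> \<int>"
        using F(1) less.IH by (intro Ints_sum Ints_mult) (auto simp: integral_fps_def)
      ultimately show ?thesis by simp
    qed (use F in simp)
  qed
qed

section \<open>Taylor coefficients of the eta quotient\<close>

definition euler_fps :: "complex fps" where
  "euler_fps = fps_expansion euler_fun 0"

lemma has_fps_expansion_euler_fun: "euler_fun has_fps_expansion euler_fps"
  unfolding euler_fps_def
  by (rule has_fps_expansion_fps_expansion[OF _ _ holomorphic_euler_fun]) auto

lemma euler_fps_0: "fps_nth euler_fps 0 = 1"
proof -
  have "(\<lambda>n. \<Prod>k<n. 1 - 0 * 0 ^ k :: complex) \<longlonglongrightarrow> qprod 0 0"
    by (rule qprod_LIMSEQ) simp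
  then have "qprod 0 0 = 1"
    by (simp add: LIMSEQ_const_iff)
  then show ?thesis
    using has_fps_expansion_imp_0_eq_fps_nth_0[OF has_fps_expansion_euler_fun]
    by (simp add: euler_fun_def)
qed

text \<open>The partial products are polynomials with integer coefficients. Under locally uniform
  convergence their Taylor coefficients converge, and the integers form a closed set.\<close>

lemma integral_euler_fps: "integral_fps euler_fps"
  unfolding integral_fps_def
proof
  fix n
  define p where "p N q = (\<Prod>n<N. 1 - q ^ Suc n)" for N and q :: complex
  define P :: "nat \<Rightarrow> complex fps" where "P N = (\<Prod>n<N. 1 - fps_X ^ Suc n)" for N
  have exp: "p N has_fps_expansion P N" for N
    unfolding p_def[abs_def] P_def by (intro fps_expansion_intros)
  have "integral_fps (P N)" for N
    unfolding P_def
    by (intro integral_fps_prod) (auto simp: integral_fps_def simp del: power_Suc)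
  then have int: "(deriv ^^ n) (p N) 0 / fact n \<in> \<int>" for N
    using fps_nth_fps_expansion[OF exp[of N], of n] by (metis integral_fps_def)
  have "(\<lambda>N. (deriv ^^ n) (p N) 0) \<longlonglongrightarrow> (deriv ^^ n) euler_fun 0"
  proof (rule higher_deriv_complex_uniform_limit)
    show "uniform_limit (ball 0 (1/2)) p euler_fun sequentially"
      by (rule uniform_limit_on_subset[OF uniform_limit_euler_fun[of "1/2", folded p_def]]) auto
    show "\<forall>\<^sub>F N in sequentially. p N holomorphic_on ball 0 (1/2)"
      unfolding p_def[abs_def] by (intro always_eventually allI holomorphic_intros)
  qed auto
  then have "(\<lambda>N. (deriv ^^ n) (p N) 0 / fact n) \<longlonglongrightarrow> (deriv ^^ n) euler_fun 0 / fact n"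
    by (intro tendsto_intros) auto
  then have "(deriv ^^ n) euler_fun 0 / fact n \<in> \<int>"
    by (rule Lim_in_closed_set[OF closed_Ints, rotated 2]) (auto simp: int)
  then show "fps_nth euler_fps n \<in> \<int>"
    using fps_nth_fps_expansion[OF has_fps_expansion_euler_fun, of n] by simp
qed

text \<open>A square root of x times the Hauptmodul, with x = e2pi z. Its integrality makes the
  Hauptmodul a square up to a shift, the source of all parity statements.\<close>

definition hauptmodul_root :: "complex \<Rightarrow> complex" where
  "hauptmodul_root x = euler_fun (x ^ 2) ^ 2 * euler_fun (x ^ 5) *
     inverse (euler_fun x * euler_fun (x ^ 10) ^ 2)"

lemma hauptmodul_root_expansion:
  obtains X where "hauptmodul_root has_fps_expansion X" "integral_fps X" "fps_nth X 0 = 1"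
proof -
  define E where "E k = fps_compose euler_fps (fps_X ^ k)" for k
  have E: "(\<lambda>x. euler_fun (x ^ k)) has_fps_expansion E k" if "k > 0" for k
    using has_fps_expansion_compose[OF has_fps_expansion_euler_fun has_fps_expansion_fps_X_power[of k]] that
    by (simp add: o_def E_def)
  have E0: "fps_nth (E k) 0 = 1" for k
    by (simp add: E_def euler_fps_0)
  have intE: "integral_fps (E k)" for k
    unfolding E_def by (intro integral_fps_compose integral_euler_fps integral_fps_X_power)
  define X where "X = E 2 ^ 2 * E 5 * inverse (E 1 * E 10 ^ 2)"
  show ?thesis
  proof (rule that)
    have "(\<lambda>x. euler_fun (x ^ 2) ^ 2 * euler_fun (x ^ 5) *
        inverse (euler_fun (x ^ 1) * euler_fun (x ^ 10) ^ 2)) has_fps_expansion X"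
      unfolding X_def by (intro fps_expansion_intros E) (auto simp: E0 fps_power_zeroth)
    then show "hauptmodul_root has_fps_expansion X"
      by (simp add: hauptmodul_root_def[abs_def])
    show "integral_fps X"
      unfolding X_def
      by (intro integral_fps_mult integral_fps_power integral_fps_inverse intE)
        (auto simp: E0 fps_power_zeroth)
    show "fps_nth X 0 = 1"
      by (simp add: X_def E0 fps_power_zeroth)
  qed
qed

lemma hauptmodul_eq: "hauptmodul z = inverse (e2pi z) * hauptmodul_root (e2pi z) ^ 2"
proof -
  have H: "eta_sq (numeral k * z) = e2pi (numeral k * z / 12) * euler_fun (e2pi z ^ numeral k) ^ 2" for k
    by (simp add: eta_sq_def e2pi_numeral_mult)
  \<comment> \<open>The exponents add up to (4 + 5 - 1 - 20) / 12 = -1, a simple pole at q =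
    0.\<close>
  have "e2pi (2 * (2 * z / 12) + 5 * z / 12 - (z / 12 + 2 * (10 * z / 12))) = inverse (e2pi z)"
    unfolding e2pi_minus[symmetric] by (rule arg_cong[of _ _ e2pi]) (simp add: field_simps)
  then have 1: "e2pi (2 * z / 12) ^ 2 * e2pi (5 * z / 12) / (e2pi (z / 12) * e2pi (10 * z / 12) ^ 2) =
      inverse (e2pi z)"
    by (simp only: e2pi_diff e2pi_add e2pi_numeral_mult)
  have 2: "(a * x\<^sup>2)\<^sup>2 * (b * y\<^sup>2) / ((c * u\<^sup>2) * (d * v\<^sup>2)\<^sup>2) =
      (a\<^sup>2 * b / (c * d\<^sup>2)) * (x\<^sup>2 * y * inverse (u * v\<^sup>2))\<^sup>2" for a b c d x y u v :: complex
    by (simp add: divide_inverse power2_eq_square mult_ac)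
  show ?thesis
    unfolding hauptmodul_eta_sq H hauptmodul_root_def eta_sq_def[of z] by (simp only: 1 2)
qed

lemma hauptmodul_q_expansion:
  obtains X where "has_q_expansion 1 hauptmodul (fls_X_inv * fps_to_fls (X ^ 2))"
    "integral_fps X" "fps_nth X 0 = 1"
proof -
  obtain X where X: "hauptmodul_root has_fps_expansion X" "integral_fps X" "fps_nth X 0 = 1"
    by (rule hauptmodul_root_expansion)
  have "(\<lambda>x. inverse x * hauptmodul_root x ^ 2) has_laurent_expansion fls_X_inv * fps_to_fls (X ^ 2)"
    by (intro laurent_expansion_intros has_laurent_expansion_fps has_fps_expansion_power X)
  moreover have "hauptmodul z = inverse (exp (2 * of_real pi * \<i> * z / of_nat 1)) *
      hauptmodul_root (exp (2 * of_real pi * \<i> * z / of_nat 1)) ^ 2" for z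
    using hauptmodul_eq[of z] by (simp add: e2pi_def)
  ultimately have "has_q_expansion 1 hauptmodul (fls_X_inv * fps_to_fls (X ^ 2))"
    unfolding has_q_expansion_def by blast
  with X that show ?thesis by blast
qed

subsection \<open>Uniqueness\<close>

abbreviation Im_at_top :: "complex filter" where
  "Im_at_top \<equiv> filtercomap Im at_top"

lemma eventually_Im_at_top: "eventually P Im_at_top \<longleftrightarrow> (\<exists>Y. \<forall>z. Im z > Y \<longrightarrow> P z)"
  by (rule eventually_filtercomap_at_top_dense)

text \<open>The map to \<open>q\<close> sends the upper half plane onto the punctured unit disc, so
  any two functions of \<open>q\<close> representing \<open>f\<close> agree near 0.\<close>

lemma has_q_expansion_unique:
  assumes "h > 0" "has_q_expansion h f F" "has_q_expansion h f G"
  shows "F = G"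
proof -
  let ?q = "\<lambda>z. exp (2 * of_real pi * \<i> * z / of_nat h) :: complex"
  obtain f1 f2 where f1: "f1 has_laurent_expansion F" "\<And>z. Im z > 0 \<Longrightarrow> f z = f1 (?q z)"
    and f2: "f2 has_laurent_expansion G" "\<And>z. Im z > 0 \<Longrightarrow> f z = f2 (?q z)"
    using assms(2,3) unfolding has_q_expansion_def upper_half_plane_def by blast
  have "f1 x = f2 x" if "x \<in> ball 0 1 - {0}" for x
  proof -
    \<comment> \<open>A preimage of \<open>x\<close>; its imaginary part is positive because ln
      (norm x) is negative.\<close>
    define z where "z = of_nat h * Ln x / (2 * of_real pi * \<i>)"
    have x: "x \<noteq> 0" "norm x < 1" using that by auto
    have "z = of_real (real h / (2 * pi)) * (- \<i> * Ln x)"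
      by (simp add: z_def field_simps)
    then have "Im z = - (real h / (2 * pi)) * ln (norm x)"
      using x by (simp add: Re_Ln)
    moreover have "ln (norm x) < 0"
      using x by simp
    ultimately have "Im z > 0"
      using assms(1) by (simp add: mult_neg_neg zero_less_mult_iff divide_less_0_iff mult_less_0_iff)
    moreover have "?q z = x"
      using x assms(1) by (simp add: z_def)
    ultimately show ?thesis
      using f1(2)[of z] f2(2)[of z] by simp
  qed
  moreover have "eventually (\<lambda>x. x \<in> ball 0 1 - {0}) (at (0::complex))"
    by (intro eventually_at_in_open) auto
  ultimately have "eventually (\<lambda>x. f1 x = f2 x) (at 0)"
    by (auto elim: eventually_mono)
  then have "f1 has_laurent_expansion G"
    using has_laurent_expansion_cong f2(1) by blast
  with f1(1) show ?thesis
    by (rule has_laurent_expansion_unique)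
qed

lemma has_q_expansion_tendsto:
  assumes "h > 0" "has_q_expansion h f F" "\<And>n. n < 0 \<Longrightarrow> fls_nth F n = 0"
  shows "(f \<longlongrightarrow> fls_nth F 0) Im_at_top"
proof -
  define q where "q z = exp (2 * of_real pi * \<i> * z / of_nat h)" for z :: complex
  obtain g where g: "g has_laurent_expansion F" "\<And>z. Im z > 0 \<Longrightarrow> f z = g (q z)"
    using assms(2) unfolding has_q_expansion_def upper_half_plane_def q_def by blast
  have "fls_subdegree F \<ge> 0"
    using assms(3) by (cases "F = 0") (auto intro: fls_subdegree_geI)
  then have lim: "(g \<longlongrightarrow> fls_nth F 0) (at 0)"
    using g(1) by (intro has_laurent_expansion_imp_tendsto_0)
  have "((\<lambda>y. exp (- (2 * pi / real h) * y)) \<longlongrightarrow> 0) at_top"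
    using assms(1)
    by (intro filterlim_compose[OF exp_at_bot] filterlim_tendsto_neg_mult_at_bot[OF tendsto_const])
      (auto intro: filterlim_ident)
  then have "((\<lambda>z. exp (- (2 * pi / real h) * Im z)) \<longlongrightarrow> 0) Im_at_top"
    by (rule filterlim_compose) (rule filterlim_filtercomap)
  then have "((\<lambda>z. norm (q z)) \<longlongrightarrow> 0) Im_at_top"
    by (simp add: q_def)
  then have "(q \<longlongrightarrow> 0) Im_at_top"
    by (rule tendsto_norm_zero_cancel)
  moreover have "q z \<noteq> 0" for z
    by (simp add: q_def)
  ultimately have "filterlim q (at 0) Im_at_top"
    by (simp add: filterlim_at)
  then have "((\<lambda>z. g (q z)) \<longlongrightarrow> fls_nth F 0) Im_at_top"
    by (rule filterlim_compose[OF lim])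
  moreover have "eventually (\<lambda>z. g (q z) = f z) Im_at_top"
    unfolding eventually_Im_at_top using g(2) by (auto intro!: exI[of _ 0])
  ultimately show ?thesis
    using Lim_transform_eventually by blast
qed

section \<open>Vanishing of invariant functions that are bounded at the cusps\<close>

lemma mob_mob:
  assumes "Im z > 0" "a' * d' - b' * c' = 1"
  shows "mob a b c d (mob a' b' c' d' z) =
    mob (a * a' + b * c') (a * b' + b * d') (c * a' + d * c') (c * b' + d * d') z"
proof -
  define w where "w = of_int c' * z + (of_int d' :: complex)"
  have w: "w \<noteq> 0"
    unfolding w_def by (rule mob_denom_det_nonzero[OF assms])
  have m: "mob a' b' c' d' z = (of_int a' * z + of_int b') / w"
    by (simp only: mob_def w_def)
  have *: "of_int x * mob a' b' c' d' z + of_int y =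
      (of_int x * (of_int a' * z + of_int b') + of_int y * w) / w" for x y
    using w by (simp add: m field_simps)
  have "mob a b c d (mob a' b' c' d' z) =
      ((of_int a * (of_int a' * z + of_int b') + of_int b * w) / w) /
      ((of_int c * (of_int a' * z + of_int b') + of_int d * w) / w)"
    unfolding mob_def[of a b] * ..
  also have "\<dots> = (of_int a * (of_int a' * z + of_int b') + of_int b * w) /
      (of_int c * (of_int a' * z + of_int b') + of_int d * w)"
    using w by simp
  also have "\<dots> = mob (a * a' + b * c') (a * b' + b * d') (c * a' + d * c') (c * b' + d * d') z"
    by (simp add: mob_def w_def algebra_simps)
  finally show ?thesis .
qed

lemma mob_inverse:
  assumes "Im z > 0" "a * d - b * c = 1"
  shows "mob a b c d (mob d (- b) (- c) a z) = z"
proof -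
  have "mob a b c d (mob d (- b) (- c) a z) =
      mob (a * d - b * c) 0 0 (a * d - b * c) z"
    using assms by (subst mob_mob) (auto simp: algebra_simps)
  then show ?thesis
    using assms(2) by (simp add: mob_def)
qed

lemma holomorphic_mob:
  assumes "a * d - b * c = 1"
  shows "mob a b c d holomorphic_on {z. Im z > 0}"
  unfolding mob_def[abs_def] using mob_denom_det_nonzero(1)[OF _ assms]
  by (intro holomorphic_intros) auto

text \<open>Where one factor is nonzero, on an open set, the product of the others vanishes; by the
  identity theorem it then vanishes everywhere.\<close>

lemma holomorphic_prod_eq_0:
  assumes "finite A" "open S" "connected S" "S \<noteq> {}"
    and "\<And>i. i \<in> A \<Longrightarrow> f i holomorphic_on S"
    and "\<And>z. z \<in> S \<Longrightarrow> (\<Prod>i\<in>A. f i z) = 0"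
  obtains i where "i \<in> A" "\<And>z. z \<in> S \<Longrightarrow> f i z = 0"
proof -
  have "\<exists>i\<in>A. \<forall>z\<in>S. f i z = 0"
    using assms(1,5,6)
  proof (induction A rule: finite_induct)
    case empty
    then show ?case using assms(4) by auto
  next
    case (insert j A)
    show ?case
    proof (cases "\<forall>z\<in>S. f j z = 0")
      case False
      then obtain w where w: "w \<in> S" "f j w \<noteq> 0" by blast
      define P where "P z = (\<Prod>i\<in>A. f i z)" for z
      have hol: "f j holomorphic_on S" "P holomorphic_on S"
        unfolding P_def[abs_def] using insert.prems by (auto intro!: holomorphic_intros)
      define U where "U = {z \<in> S. f j z \<noteq> 0}"
      have "U = S \<inter> f j -` (- {0})"
        by (auto simp: U_def)
      then have "open U"
        using continuous_open_preimage[OF holomorphic_on_imp_continuous_on[OF hol(1)] assms(2), of "- {0}"]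
        by (simp add: open_Compl)
      have "P z = 0" if "z \<in> U" for z
        using insert.prems(2)[of z] insert.hyps that by (auto simp: P_def U_def)
      then have "P z = 0" if "z \<in> S" for z
        using analytic_continuation_open[of U S P "\<lambda>_. 0" z] \<open>open U\<close> w that hol assms(2,3)
        by (auto simp: U_def)
      then have "\<exists>i\<in>A. \<forall>z\<in>S. f i z = 0"
        using insert.prems by (intro insert.IH) (auto simp: P_def)
      then show ?thesis by blast
    qed blast
  qed
  with that show ?thesis by blast
qed

text \<open>If \<open>\<bar>Re z\<bar> \<le> 1/2\<close> and \<open>Im z < 1/2\<close>, then \<open>z \<mapsto> -1/z\<close> at least doubles the imaginary part.\<close>
lemma fundamental_strip:
  assumes T: "\<And>z k. Im z > 0 \<Longrightarrow> P (z + of_int k) = P z"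
    and S: "\<And>z. Im z > 0 \<Longrightarrow> P (- 1 / z) = P z"
    and "Im z > 0"
  obtains w where "P w = P z" "\<bar>Re w\<bar> \<le> 1 / 2" "Im w \<ge> 1 / 2"
proof -
  \<comment> \<open>\<open>n\<close> counts how often the imaginary part may have to be doubled to
    reach 1/2; for n = 0 a translation suffices.\<close>
  have "\<exists>w. P w = P z \<and> \<bar>Re w\<bar> \<le> 1 / 2 \<and> Im w \<ge> 1 / 2" if "Im z \<ge> (1 / 2) ^ Suc n" for n z
    using that
  proof (induction n arbitrary: z)
    case (0 z)
    define w where "w = z + of_int (- round (Re z))"
    have "\<bar>Re w\<bar> \<le> 1 / 2"
      using of_int_round_abs_le[of "Re z"] by (simp add: w_def abs_minus_commute)
    then show ?case
      using 0 T[of z "- round (Re z)"] by (intro exI[of _ w]) (auto simp: w_def)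
  next
    case (Suc n z)
    have z: "Im z > 0"
      using less_le_trans[OF _ Suc.prems] by simp
    define w where "w = z + of_int (- round (Re z))"
    have Re: "\<bar>Re w\<bar> \<le> 1 / 2"
      using of_int_round_abs_le[of "Re z"] by (simp add: w_def abs_minus_commute)
    have w: "Im w = Im z" "P w = P z"
      using T[OF z] by (simp_all only: w_def) simp
    show ?case
    proof (cases "Im w \<ge> 1 / 2")
      case True
      then show ?thesis using Re w by blast
    next
      case False
      have "(Re w)\<^sup>2 \<le> (1 / 2)\<^sup>2"
        using Re by (metis abs_le_square_iff abs_of_nonneg zero_le_divide_1_iff zero_le_numeral)
      moreover have "(Im w)\<^sup>2 \<le> (1 / 2)\<^sup>2"
        using False w z by (intro power_mono) auto
      ultimately have le: "(Re w)\<^sup>2 + (Im w)\<^sup>2 \<le> 1 / 2"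
        by (simp add: power2_eq_square)
      have pos: "(Re w)\<^sup>2 + (Im w)\<^sup>2 > 0"
        using w z by (intro add_nonneg_pos) auto
      have "2 * Im w \<le> Im w / ((Re w)\<^sup>2 + (Im w)\<^sup>2)"
        using le pos w z mult_left_mono[OF le, of "2 * Im w"] by (simp add: field_simps)
      also have "\<dots> = Im (- 1 / w)"
        by (simp add: Im_divide)
      finally have "(1 / 2) ^ Suc n \<le> Im (- 1 / w)"
        using Suc.prems w by simp
      from Suc.IH[OF this] show ?thesis
        using S[of w] w z by auto
    qed
  qed
  moreover obtain n where "(1 / 2) ^ n < Im z"
    using real_arch_pow_inv[of "Im z" "1 / 2"] assms(3) by auto
  then have "Im z \<ge> (1 / 2) ^ Suc n"
    by (simp add: field_simps)
  ultimately show ?thesis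
    using that by blast
qed

text \<open>If \<open>P z\<close> were nonzero, decay at infinity would confine the search for a
  maximum of the modulus to a compact box. The maximum modulus principle then makes \<open>P\<close>
  constant, against the decay.\<close>

lemma level_one_vanishing:
  assumes hol: "P holomorphic_on {z. Im z > 0}"
    and T: "\<And>z k. Im z > 0 \<Longrightarrow> P (z + of_int k) = P z"
    and S: "\<And>z. Im z > 0 \<Longrightarrow> P (- 1 / z) = P z"
    and lim: "(P \<longlongrightarrow> 0) Im_at_top"
    and z: "Im z > 0"
  shows "P z = 0"
proof (rule ccontr)
  assume nz: "P z \<noteq> 0"
  have "eventually (\<lambda>w. norm (P w) < norm (P z)) Im_at_top"
    using tendstoD[OF lim, of "norm (P z)"] nz by simp
  then obtain Y where Y: "\<And>w. Im w > Y \<Longrightarrow> norm (P w) < norm (P z)"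
    unfolding eventually_Im_at_top by blast
  define K where "K = cbox (Complex (- 1 / 2) (1 / 2)) (Complex (1 / 2) Y)"
  have K_iff: "w \<in> K \<longleftrightarrow> \<bar>Re w\<bar> \<le> 1 / 2 \<and> Im w \<ge> 1 / 2 \<and> Im w \<le> Y" for w
    by (auto simp: K_def in_cbox_complex_iff abs_le_iff)
  have K_sub: "K \<subseteq> {z. Im z > 0}"
    by (auto simp: K_iff)
  have rep: "\<exists>w. P w = P u \<and> \<bar>Re w\<bar> \<le> 1 / 2 \<and> Im w \<ge> 1 / 2" if "Im u > 0" for u
    using fundamental_strip[of P, OF T S that] by metis
  obtain w where w: "P w = P z" "\<bar>Re w\<bar> \<le> 1 / 2" "Im w \<ge> 1 / 2"
    using rep[OF z] by blast
  \<comment> \<open>Above height \<open>Y\<close> the modulus is smaller than that of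
    \<open>P z\<close>, which is attained at \<open>w\<close>; so the box is nonempty.\<close>
  have wK: "w \<in> K"
    using w Y[of w] by (force simp: K_iff)
  have "continuous_on K (\<lambda>w. norm (P w))"
    using continuous_on_subset[OF holomorphic_on_imp_continuous_on[OF hol] K_sub]
    by (intro continuous_intros)
  moreover have "compact K"
    by (simp add: K_def)
  ultimately obtain \<xi> where \<xi>: "\<xi> \<in> K" "\<And>w. w \<in> K \<Longrightarrow> norm (P w) \<le> norm (P \<xi>)"
    using continuous_attains_sup[of K "\<lambda>w. norm (P w)"] wK by blast
  have max: "norm (P u) \<le> norm (P \<xi>)" if u: "Im u > 0" for u
  proof -
    obtain v where v: "P v = P u" "\<bar>Re v\<bar> \<le> 1 / 2" "Im v \<ge> 1 / 2"
      using rep[OF u] by blast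
    show ?thesis
    proof (cases "Im v \<le> Y")
      case True
      then have "v \<in> K" using v by (simp add: K_iff)
      then show ?thesis using \<xi>(2)[of v] v(1) by simp
    next
      case False
      then have "norm (P u) < norm (P w)"
        using Y[of v] v(1) w(1) by simp
      then show ?thesis using \<xi>(2)[OF wK] by simp
    qed
  qed
  have "P constant_on {z. Im z > 0}"
    by (rule maximum_modulus_principle[OF hol open_upper_half connected_upper_half open_upper_half])
      (use max \<xi> K_sub in auto)
  then obtain c where c: "\<And>z. Im z > 0 \<Longrightarrow> P z = c"
    by (auto simp: constant_on_def)
  have "P (Complex 0 (max Y 0 + 1)) = P z"
    using c[of "Complex 0 (max Y 0 + 1)"] c[OF z] by simp
  moreover have "norm (P (Complex 0 (max Y 0 + 1))) < norm (P z)"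
    by (rule Y) auto
  ultimately show False by simp
qed

text \<open>The product of the finitely many translates of \<open>\<phi>\<close> has level \<open>1\<close>.\<close>
lemma Gamma0_vanishing:
  fixes N :: nat
  assumes N: "N > 0"
    and hol: "\<phi> holomorphic_on {z. Im z > 0}"
    and inv: "\<And>a b c d z. a * d - b * c = 1 \<Longrightarrow> int N dvd c \<Longrightarrow> Im z > 0 \<Longrightarrow>
      \<phi> (mob a b c d z) = \<phi> z"
    and bdd: "\<And>a b c d. a * d - b * c = 1 \<Longrightarrow>
      \<exists>B. eventually (\<lambda>z. norm (\<phi> (mob a b c d z)) \<le> B) Im_at_top"
    and lim: "(\<phi> \<longlongrightarrow> 0) Im_at_top"
    and z: "Im z > 0"
  shows "\<phi> z = 0"
proof -
  define H where "H = {z. Im z > 0}"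
  \<comment> \<open>Restriction makes translates that agree on \<open>H\<close> equal as functions,
    so each occurs once in the set \<open>\<Phi>\<close>.\<close>
  define tr where "tr a b c d = restrict (\<lambda>z. \<phi> (mob a b c d z)) H" for a b c d
  define \<Phi> where "\<Phi> = {tr a b c d | a b c d. a * d - b * c = 1}"
  \<comment> \<open>Bottom rows congruent modulo \<open>N\<close> belong to the same right coset:
    the second matrix times the inverse of the first has lower left entry c' d - d' c.\<close>
  have tr_eq: "tr a b c d = tr a' b' c' d'"
    if det: "a * d - b * c = 1" "a' * d' - b' * c' = 1"
      and cong: "c mod int N = c' mod int N" "d mod int N = d' mod int N" for a b c d a' b' c' d'
  proof -
    have 1: "(a' * d - b' * c) * (d' * a - c' * b) - (b' * a - a' * b) * (c' * d - d' * c) = 1"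
    proof -
      have "(a' * d - b' * c) * (d' * a - c' * b) - (b' * a - a' * b) * (c' * d - d' * c) =
          (a * d - b * c) * (a' * d' - b' * c')"
        by (simp add: algebra_simps)
      then show ?thesis using det by simp
    qed
    have "(c' * d - d' * c) mod int N = (c * d - d * c) mod int N"
      using cong by (intro mod_diff_cong mod_mult_cong) auto
    then have 2: "int N dvd c' * d - d' * c"
      by (simp add: dvd_eq_mod_eq_0 mult.commute)
    have "\<phi> (mob a' b' c' d' z) = \<phi> (mob a b c d z)" if z: "Im z > 0" for z
    proof -
      have "mob (a' * d - b' * c) (b' * a - a' * b) (c' * d - d' * c) (d' * a - c' * b) (mob a b c d z) =
          mob (a' * (a * d - b * c)) (b' * (a * d - b * c)) (c' * (a * d - b * c)) (d' * (a * d - b * c)) z"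
        by (subst mob_mob[OF z det(1)]) (simp add: algebra_simps)
      then show ?thesis
        using inv[OF 1 2 Im_mob_pos[OF z det(1)]] det(1) by simp
    qed
    then show ?thesis
      by (auto simp: tr_def H_def fun_eq_iff)
  qed
  have "finite \<Phi>"
  proof -
    \<comment> \<open>One translate is chosen for each pair of residues, so the finite set of pairs
      covers \<open>\<Phi>\<close>.\<close>
    define \<Psi> where "\<Psi> = (\<lambda>(r, s). SOME g. \<exists>a b c d. g = tr a b c d \<and> a * d - b * c = 1 \<and>
      c mod int N = r \<and> d mod int N = s)"
    have "tr a b c d = \<Psi> (c mod int N, d mod int N)" if "a * d - b * c = 1" for a b c d
    proof -
      have "\<exists>g. \<exists>a' b' c' d'. g = tr a' b' c' d' \<and> a' * d' - b' * c' = 1 \<and>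
          c' mod int N = c mod int N \<and> d' mod int N = d mod int N"
        using that by blast
      from someI_ex[OF this] show ?thesis
        unfolding \<Psi>_def using tr_eq[OF that] by auto
    qed
    then have "\<Phi> \<subseteq> \<Psi> ` ({0..<int N} \<times> {0..<int N})"
      using N by (force simp: \<Phi>_def)
    then show ?thesis
      by (rule finite_subset) auto
  qed
  define P where "P z = (\<Prod>g\<in>\<Phi>. g z)" for z
  have hol_\<Phi>: "g holomorphic_on H" if g: "g \<in> \<Phi>" for g
  proof -
    obtain a b c d where g: "g = tr a b c d" and det: "a * d - b * c = 1"
      using g by (auto simp: \<Phi>_def)
    have "(\<phi> \<circ> mob a b c d) holomorphic_on H"
      unfolding H_def using Im_mob_pos[OF _ det]
      by (intro holomorphic_on_compose_gen[OF holomorphic_mob[OF det] hol]) auto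
    then show ?thesis
      by (rule holomorphic_transform) (auto simp: g tr_def H_def)
  qed
  have inv_P: "P (mob a b c d z) = P z" if det: "a * d - b * c = 1" and z: "Im z > 0" for a b c d z
  proof -
    \<comment> \<open>Translation maps \<open>\<Phi>\<close> injectively into itself. As
      \<open>\<Phi>\<close> is finite it is a permutation, which leaves the product
      unchanged.\<close>
    define R where "R g = restrict (\<lambda>z. g (mob a b c d z)) H" for g :: "complex \<Rightarrow> complex"
    have det': "d * a - (- b) * (- c) = 1" using det by (simp add: mult.commute)
    have "R ` \<Phi> \<subseteq> \<Phi>"
    proof
      fix g assume "g \<in> R ` \<Phi>"
      then obtain a' b' c' d' where g: "g = R (tr a' b' c' d')" and det2: "a' * d' - b' * c' = 1"
        by (auto simp: \<Phi>_def)
      have "g = tr (a' * a + b' * c) (a' * b + b' * d) (c' * a + d' * c) (c' * b + d' * d)"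
        using mob_mob[OF _ det] Im_mob_pos[OF _ det]
        by (auto simp: g R_def tr_def H_def fun_eq_iff)
      moreover have "(a' * a + b' * c) * (c' * b + d' * d) - (a' * b + b' * d) * (c' * a + d' * c) =
          (a' * d' - b' * c') * (a * d - b * c)"
        by (simp add: algebra_simps)
      ultimately show "g \<in> \<Phi>"
        unfolding \<Phi>_def using det det2 by auto
    qed
    moreover have "inj_on R \<Phi>"
    proof (rule inj_onI)
      fix g g' assume gg: "g \<in> \<Phi>" "g' \<in> \<Phi>" and eq: "R g = R g'"
      have "g w = g' w" if w: "w \<in> H" for w
      proof -
        define v where "v = mob d (- b) (- c) a w"
        have v: "v \<in> H" "mob a b c d v = w"
          using w Im_mob_pos[OF _ det', of w] mob_inverse[OF _ det, of w]
          by (auto simp: v_def H_def)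
        show ?thesis
          using fun_cong[OF eq, of v] v by (simp add: R_def)
      qed
      moreover have "g w = undefined" "g' w = undefined" if "w \<notin> H" for w
        using gg that by (auto simp: \<Phi>_def tr_def)
      ultimately show "g = g'"
        by (metis ext)
    qed
    ultimately have "R ` \<Phi> = \<Phi>"
      using \<open>finite \<Phi>\<close> by (intro endo_inj_surj)
    have "P z = (\<Prod>g\<in>R ` \<Phi>. g z)"
      unfolding \<open>R ` \<Phi> = \<Phi>\<close> by (simp add: P_def)
    also have "\<dots> = (\<Prod>g\<in>\<Phi>. R g z)"
      using prod.reindex[OF \<open>inj_on R \<Phi>\<close>] by (simp add: o_def)
    also have "\<dots> = P (mob a b c d z)"
      using z by (simp add: P_def R_def H_def)
    finally show ?thesis ..
  qed
  have "P z = 0" if "Im z > 0" for z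
  proof (rule level_one_vanishing[OF _ _ _ _ that])
    show "P holomorphic_on {z. Im z > 0}"
      unfolding P_def[abs_def] using hol_\<Phi> by (intro holomorphic_intros) (auto simp: H_def)
    show "P (z + of_int k) = P z" if "Im z > 0" for z k
      using inv_P[of 1 1 k 0 z] that by (simp add: mob_def)
    show "P (- 1 / z) = P z" if "Im z > 0" for z
      using inv_P[of 0 0 "- 1" 1 z] that by (simp add: mob_def)
    have "\<exists>B. eventually (\<lambda>z. norm (g z) \<le> B) Im_at_top" if g\<Phi>: "g \<in> \<Phi>" for g
    proof -
      obtain a b c d where g: "g = tr a b c d" and det: "a * d - b * c = 1"
        using g\<Phi> by (auto simp: \<Phi>_def)
      obtain B where B: "eventually (\<lambda>z. norm (\<phi> (mob a b c d z)) \<le> B) Im_at_top"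
        using bdd[OF det] by blast
      moreover have "eventually (\<lambda>z. z \<in> H) Im_at_top"
        unfolding eventually_Im_at_top H_def by (auto intro!: exI[of _ 0])
      ultimately have "eventually (\<lambda>z. norm (g z) \<le> B) Im_at_top"
        by eventually_elim (simp add: g tr_def)
      then show ?thesis ..
    qed
    then obtain B where "\<And>g. g \<in> \<Phi> \<Longrightarrow> eventually (\<lambda>z. norm (g z) \<le> B g) Im_at_top"
      by metis
    then have ev: "eventually (\<lambda>z. \<forall>g\<in>\<Phi>. norm (g z) \<le> B g) Im_at_top"
      using \<open>finite \<Phi>\<close> by (intro eventually_ball_finite) auto
    \<comment> \<open>The identity translate is \<open>\<phi>\<close> itself and tends to 0; the
      other factors stay bounded, hence the product tends to 0.\<close>
    define g0 where "g0 = tr 1 0 0 1"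
    have "(1::int) * 1 - 0 * 0 = 1" by simp
    then have g0: "g0 \<in> \<Phi>"
      unfolding \<Phi>_def g0_def by blast
    define C where "C = (\<Prod>g\<in>\<Phi> - {g0}. B g)"
    have "eventually (\<lambda>z. z \<in> H) Im_at_top"
      unfolding eventually_Im_at_top H_def by (auto intro!: exI[of _ 0])
    with ev have "eventually (\<lambda>z. norm (P z) \<le> norm (\<phi> z) * C) Im_at_top"
    proof eventually_elim
      case (elim z)
      have "P z = g0 z * (\<Prod>g\<in>\<Phi> - {g0}. g z)"
        unfolding P_def using \<open>finite \<Phi>\<close> g0 by (rule prod.remove)
      moreover have "g0 z = \<phi> z"
        using elim by (simp add: g0_def tr_def mob_def)
      moreover have "norm (\<Prod>g\<in>\<Phi> - {g0}. g z) \<le> C"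
        unfolding C_def prod_norm[symmetric] using elim by (intro prod_mono) auto
      ultimately show ?case
        by (simp add: norm_mult mult_left_mono)
    qed
    moreover have "((\<lambda>z. norm (\<phi> z) * C) \<longlongrightarrow> 0) Im_at_top"
      using tendsto_mult_right[OF tendsto_norm[OF lim], of C] by simp
    ultimately show "(P \<longlongrightarrow> 0) Im_at_top"
      by (rule Lim_null_comparison)
  qed
  \<comment> \<open>Some factor vanishes identically; the inverse matrix carries this back to
    \<open>\<phi>\<close>.\<close>
  then obtain g where g: "g \<in> \<Phi>" "\<And>z. z \<in> H \<Longrightarrow> g z = 0"
    using holomorphic_prod_eq_0[of \<Phi> H "\<lambda>g. g"] \<open>finite \<Phi>\<close> hol_\<Phi> z open_upper_half connected_upper_half
    by (auto simp: P_def H_def)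
  then obtain a b c d where gt: "g = tr a b c d" and det: "a * d - b * c = 1"
    by (auto simp: \<Phi>_def)
  have "d * a - (- b) * (- c) = 1" using det by (simp add: mult.commute)
  then have "Im (mob d (- b) (- c) a z) > 0"
    by (rule Im_mob_pos[OF z])
  then show ?thesis
    using g(2)[of "mob d (- b) (- c) a z"] mob_inverse[OF z det] by (simp add: gt tr_def H_def)
qed

subsection \<open>Integer polynomials in a Laurent series\<close>

text \<open>One integer polynomial is evaluated both at values of the Hauptmodul and at its Laurent
  series.\<close>

definition ipoly :: "int poly \<Rightarrow> 'a :: comm_ring_1 \<Rightarrow> 'a" where
  "ipoly p x = poly (map_poly of_int p) x"

lemma ipoly_0 [simp]: "ipoly 0 x = 0"
  by (simp add: ipoly_def)

lemma ipoly_pCons [simp]: "ipoly (pCons a p) x = of_int a + x * ipoly p x"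
  by (simp add: ipoly_def map_poly_pCons)

lemma ipoly_1 [simp]: "ipoly 1 x = 1"
  unfolding one_pCons by simp

lemma ipoly_add [simp]: "ipoly (p + q) x = ipoly p x + ipoly q x"
  by (induction p q rule: poly_induct2) (auto simp: algebra_simps)

lemma ipoly_smult [simp]: "ipoly (smult c p) x = of_int c * ipoly p x"
  by (induction p) (auto simp: algebra_simps)

lemma ipoly_mult [simp]: "ipoly (p * q) x = ipoly p x * ipoly q x"
  by (induction p) (auto simp: algebra_simps)

lemma ipoly_diff [simp]: "ipoly (p - q) x = ipoly p x - ipoly q x"
  using ipoly_add[of p "- q" x] ipoly_smult[of "- 1" q x] by simp

lemma ipoly_sum [simp]: "ipoly (sum p A) x = (\<Sum>i\<in>A. ipoly (p i) x)"
  by (induction A rule: infinite_finite_induct) auto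

lemma has_laurent_expansion_ipoly:
  assumes "g has_laurent_expansion F"
  shows "(\<lambda>x. ipoly p (g x)) has_laurent_expansion ipoly p F"
proof (induction p)
  case (pCons a p)
  have "(\<lambda>x. of_int a + g x * ipoly p (g x)) has_laurent_expansion fls_const (of_int a) + F * ipoly p F"
    by (intro laurent_expansion_intros assms pCons.IH)
  then show ?case by (simp add: fls_of_int)
qed auto

lemma has_q_expansion_ipoly:
  assumes "has_q_expansion h f F"
  shows "has_q_expansion h (\<lambda>z. ipoly p (f z)) (ipoly p F)"
  using assms has_laurent_expansion_ipoly unfolding has_q_expansion_def by fastforce

text \<open>The range of summation uses any lower bounds for the exponents instead of the exact
  subdegrees.\<close>

lemma fls_times_nth_bounds:
  fixes F G :: "'a :: comm_ring_1 fls"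
  assumes "\<forall>i<a. fls_nth F i = 0" "\<forall>i<b. fls_nth G i = 0"
  shows "fls_nth (F * G) n = (\<Sum>i=a..n - b. fls_nth F i * fls_nth G (n - i))"
proof (cases "F = 0 \<or> G = 0")
  case False
  then have le: "a \<le> fls_subdegree F" "b \<le> fls_subdegree G"
    using assms by (auto intro: fls_subdegree_geI)
  have "fls_nth (F * G) n =
      (\<Sum>i=fls_subdegree F..n - fls_subdegree G. fls_nth F i * fls_nth G (n - i))"
    by (rule fls_times_nth(2))
  also have "\<dots> = (\<Sum>i=a..n - b. fls_nth F i * fls_nth G (n - i))"
    by (rule sum.mono_neutral_left) (use le in \<open>force simp: not_le fls_eq0_below_subdegree\<close>)+
  finally show ?thesis .
qed auto

lemma fls_times_nth_eq_0:
  assumes "\<forall>i<a. fls_nth F i = 0" "\<forall>i<b. fls_nth G i = 0" "n < a + b"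
  shows "fls_nth (F * G) n = (0 :: 'a :: comm_ring_1)"
  using fls_times_nth_bounds[OF assms(1,2), of n] assms(3) by simp

lemma fls_times_nth_lowest:
  assumes "\<forall>i<a. fls_nth F i = 0" "\<forall>i<b. fls_nth G i = 0"
  shows "fls_nth (F * G) (a + b) = fls_nth F a * (fls_nth G b :: 'a :: comm_ring_1)"
  using fls_times_nth_bounds[OF assms, of "a + b"] by simp

lemma ipoly_nonneg:
  assumes "\<And>n. n < 0 \<Longrightarrow> fls_nth F n = (0 :: 'a :: comm_ring_1)" "n < 0"
  shows "fls_nth (ipoly p F) n = 0"
  using assms(2)
proof (induction p arbitrary: n)
  case (pCons a p)
  have "fls_nth (F * ipoly p F) n = 0"
    by (rule fls_times_nth_eq_0[of 0 _ 0]) (use assms(1) pCons in auto)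
  then show ?case
    using pCons.prems by (simp add: fls_of_int)
qed simp

section \<open>Integrality and residues\<close>

definition integral_fls :: "complex fls \<Rightarrow> bool" where
  "integral_fls F \<longleftrightarrow> (\<forall>n. fls_nth F n \<in> \<int>)"

lemma integral_fls_mult:
  assumes "integral_fls F" "integral_fls G"
  shows "integral_fls (F * G)"
  using assms unfolding integral_fls_def fls_times_nth(2) by (auto intro!: Ints_sum Ints_mult)

lemma integral_fls_ipoly: "integral_fls F \<Longrightarrow> integral_fls (ipoly p F)"
proof (induction p)
  case (pCons a p)
  then have "integral_fls (F * ipoly p F)"
    by (intro integral_fls_mult)
  then show ?case
    by (auto simp: integral_fls_def fls_of_int)
qed (simp add: integral_fls_def)

lemma fls_deriv_ipoly: "fls_deriv (ipoly p F) = ipoly (pderiv p) F * fls_deriv (F :: complex fls)"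
  by (induction p) (auto simp: pderiv_pCons algebra_simps)

text \<open>(k + 1) F^k F' is the derivative of F^(k+1) and has no residue. The extra power of
  \<open>F\<close> is what lets the induction on \<open>p\<close> pass from \<open>k\<close> to k +
  1.\<close>

lemma residue_ipoly_deriv: "fls_nth (F ^ k * ipoly p F * fls_deriv F) (- 1) = (0 :: complex)"
proof (induction p arbitrary: k)
  case (pCons a p)
  have "fls_nth (of_nat (Suc k) * (F ^ k * fls_deriv F)) (- 1) = 0"
    using fls_deriv_residue[of "F ^ Suc k"] by (simp only: fls_deriv_power diff_Suc_1 mult.assoc)
  then have "fls_nth (F ^ k * fls_deriv F) (- 1) = 0"
    by (simp add: fls_of_nat del: of_nat_Suc)
  moreover have "F ^ k * ipoly (pCons a p) F * fls_deriv F =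
      fls_const (of_int a) * (F ^ k * fls_deriv F) + F ^ Suc k * ipoly p F * fls_deriv F"
    by (simp add: algebra_simps fls_of_int)
  ultimately show ?case
    using pCons.IH[of "Suc k"] by simp
qed simp

text \<open>The range n \<le> 0 includes the constant term, which must vanish unless m = 0.\<close>

definition principal :: "nat \<Rightarrow> complex fls \<Rightarrow> bool" where
  "principal m F \<longleftrightarrow> (\<forall>n\<le>0. fls_nth F n = (if n = - int m then 1 else 0))"

text \<open>The symmetry of the Grunsky coefficients: \<open>F dG\<close> is a polynomial in \<open>T\<close> times \<open>dT\<close>,
  so it has no residue.\<close>
lemma grunsky_symmetry:
  assumes F: "principal m F" "F = ipoly p T" and G: "principal n G" "G = ipoly q T"
    and "m > 0" "n > 0"
  shows "of_nat m * fls_nth G (int m) = of_nat n * fls_nth F (int n)"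
proof -
  have F0: "fls_nth F i = (if i = - int m then 1 else 0)" if "i \<le> 0" for i
    using F(1) that by (auto simp: principal_def)
  have G0: "fls_nth G i = (if i = - int n then 1 else 0)" if "i \<le> 0" for i
    using G(1) that by (auto simp: principal_def)
  have "F * fls_deriv G = T ^ 0 * ipoly (p * pderiv q) T * fls_deriv T"
    by (simp add: F(2) G(2) fls_deriv_ipoly mult.assoc)
  then have "0 = fls_nth (F * fls_deriv G) (- 1)"
    by (simp only: residue_ipoly_deriv)
  also have "\<dots> = (\<Sum>i=- int m..- 1 - (- int n - 1). fls_nth F i * fls_nth (fls_deriv G) (- 1 - i))"
    using \<open>m > 0\<close> \<open>n > 0\<close> by (intro fls_times_nth_bounds) (auto simp: F0 G0)
  \<comment> \<open>For i \<le> 0 only i = -m gives a nonzero coefficient of \<open>F\<close>. For i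
    > 0 the derivative contributes -i times the coefficient of \<open>G\<close> at -i, nonzero only
    for i = n.\<close>
  also have "\<dots> = (\<Sum>i\<in>{- int m, int n}. fls_nth F i * fls_nth (fls_deriv G) (- 1 - i))"
  proof (rule sum.mono_neutral_right)
    show "\<forall>i\<in>{- int m..- 1 - (- int n - 1)} - {- int m, int n}.
        fls_nth F i * fls_nth (fls_deriv G) (- 1 - i) = 0"
    proof
      fix i assume i: "i \<in> {- int m..- 1 - (- int n - 1)} - {- int m, int n}"
      show "fls_nth F i * fls_nth (fls_deriv G) (- 1 - i) = 0"
        using i F0[of i] G0[of "- i"] by (cases "i \<le> 0") auto
    qed
  qed auto
  also have "\<dots> = of_nat m * fls_nth G (int m) - of_nat n * fls_nth F (int n)"
    using \<open>m > 0\<close> \<open>n > 0\<close> F0[of "- int m"] G0[of "- int n"] by simp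
  finally show ?thesis by simp
qed

subsection \<open>Parity\<close>

lemma half_Ints_mult: "x / 2 \<in> \<int> \<Longrightarrow> y \<in> \<int> \<Longrightarrow> x * y / 2 \<in> (\<int> :: complex set)"
  "y \<in> \<int> \<Longrightarrow> x / 2 \<in> \<int> \<Longrightarrow> y * x / 2 \<in> (\<int> :: complex set)"
  using Ints_mult[of "x / 2" y] by (simp_all add: mult.commute)

text \<open>The terms with indices i and n - i are equal, and only the middle one is left
  unpaired.\<close>

lemma fls_square_nth:
  assumes F: "integral_fls F"
  obtains S where "S \<in> \<int>"
    "fls_nth (F * F) n = 2 * S + (if even n then (fls_nth F (n div 2))\<^sup>2 else 0)"
proof -
  define d where "d = fls_subdegree F"
  define f where "f i = fls_nth F i * fls_nth F (n - i)" for i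
  define A where "A = {d..n - d}"
  have fin: "finite A" by (simp add: A_def)
  have d: "fls_nth F i = 0" if "i < d" for i
    using that by (simp add: d_def)
  have "fls_nth (F * F) n = sum f A"
    using fls_times_nth(2)[of F F n] by (simp add: f_def[abs_def] A_def d_def)
  also have "A = {i \<in> A. 2 * i < n} \<union> ({i \<in> A. n < 2 * i} \<union> {i \<in> A. 2 * i = n})"
    by auto
  also have "sum f \<dots> = sum f {i \<in> A. 2 * i < n} +
      (sum f {i \<in> A. n < 2 * i} + sum f {i \<in> A. 2 * i = n})"
    using fin by (subst sum.union_disjoint; (subst sum.union_disjoint)?) auto
  also have "sum f {i \<in> A. n < 2 * i} = sum f {i \<in> A. 2 * i < n}"
    by (rule sum.reindex_bij_witness[where i = "\<lambda>i. n - i" and j = "\<lambda>i. n - i"])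
      (auto simp: A_def f_def mult.commute)
  also have "sum f {i \<in> A. 2 * i = n} = (if even n then (fls_nth F (n div 2))\<^sup>2 else 0)"
  proof (cases "even n")
    case True
    then obtain j where j: "n = 2 * j" by blast
    have "{i \<in> A. 2 * i = n} = (if j \<in> A then {j} else {})"
      by (auto simp: j)
    moreover have "fls_nth F j = 0" if "j \<notin> A"
      using that by (intro d) (auto simp: A_def j)
    ultimately show ?thesis
      by (auto simp: j f_def power2_eq_square)
  next
    case False
    then have empty: "{i \<in> A. 2 * i = n} = {}" by auto
    show ?thesis unfolding empty using False by simp
  qed
  finally have eq: "fls_nth (F * F) n = 2 * sum f {i \<in> A. 2 * i < n} +
      (if even n then (fls_nth F (n div 2))\<^sup>2 else 0)"
    by simp
  have "sum f {i \<in> A. 2 * i < n} \<in> \<int>"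
    using F unfolding f_def integral_fls_def by (intro Ints_sum Ints_mult) auto
  with eq that show ?thesis by blast
qed

lemma fls_square_nth_even:
  assumes F: "integral_fls F" and n: "even n \<Longrightarrow> fls_nth F (n div 2) / 2 \<in> \<int>"
  shows "fls_nth (F * F) n / 2 \<in> \<int>"
proof -
  obtain S where S: "S \<in> \<int>"
    "fls_nth (F * F) n = 2 * S + (if even n then (fls_nth F (n div 2))\<^sup>2 else 0)"
    by (rule fls_square_nth[OF F])
  show ?thesis
  proof (cases "even n")
    case True
    have "fls_nth F (n div 2) * fls_nth F (n div 2) / 2 \<in> \<int>"
      using n[OF True] F by (intro half_Ints_mult) (auto simp: integral_fls_def)
    then show ?thesis
      using S True by (simp add: add_divide_distrib power2_eq_square)
  qed (use S in simp)
qed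

text \<open>Modulo \<open>2\<close>, one may start from \<open>F\<^sup>2\<close> or \<open>T F\<^sup>2\<close> with \<open>F\<close> belonging to \<open>m div 2\<close>, and
  subtract series that belong to smaller \<open>m\<close>.\<close>
lemma faber_polynomial_exists:
  fixes T :: "complex fls"
  assumes int: "integral_fls T"
    and T0: "\<And>n. n < - 1 \<Longrightarrow> fls_nth T n = 0" "fls_nth T (- 1) = 1"
    and T_even: "\<And>n. even n \<Longrightarrow> fls_nth T n / 2 \<in> \<int>"
  shows "\<exists>p. principal m (ipoly p T) \<and>
    (\<forall>k n. \<not> 2 ^ k dvd int m \<longrightarrow> 2 ^ k dvd n \<longrightarrow> fls_nth (ipoly p T) n / 2 \<in> \<int>)"
proof (induction m rule: less_induct)
  case (less m)
  show ?case
  proof (cases "m = 0")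
    case True
    then show ?thesis
      by (intro exI[of _ 1]) (auto simp: principal_def)
  next
    case False
    \<comment> \<open>The condition on \<open>k\<close> expresses that n has larger 2-adic valuation
      than l, in a form that also covers n = 0.\<close>
    obtain P where P: "\<And>l. l < m \<Longrightarrow> principal l (ipoly (P l) T)"
      "\<And>l k n. l < m \<Longrightarrow> \<not> 2 ^ k dvd int l \<Longrightarrow> 2 ^ k dvd n \<Longrightarrow>
        fls_nth (ipoly (P l) T) n / 2 \<in> \<int>"
      using less.IH by metis
    define F where "F l = ipoly (P l) T" for l
    have int_F: "integral_fls (F l)" for l
      unfolding F_def by (rule integral_fls_ipoly[OF int])
    have F0: "fls_nth (F l) n = (if n = - int l then 1 else 0)" if "n \<le> 0" "l < m" for n l
      using P(1)[OF that(2)] that(1) by (auto simp: principal_def F_def)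
    define j where "j = m div 2"
    have j: "j < m" using False by (simp add: j_def)
    define Q where "Q = F j * F j"
    have int_Q: "integral_fls Q"
      unfolding Q_def by (intro integral_fls_mult int_F)
    have Fj: "\<forall>i < (- int j). fls_nth (F j) i = 0"
      using F0[of _ j] j by auto
    have Q0: "\<forall>i < (- (2 * int j)). fls_nth Q i = 0"
      unfolding Q_def using fls_times_nth_eq_0[OF Fj Fj] by auto
    have T0': "\<forall>i < (- 1). fls_nth T i = 0"
      using T0(1) by auto
    have Q1: "fls_nth Q (- (2 * int j)) = 1"
      using fls_times_nth_lowest[OF Fj Fj] F0[of "- int j" j] j
      by (simp add: Q_def)
    have Q_even: "fls_nth Q n / 2 \<in> \<int>" if "even n \<Longrightarrow> fls_nth (F j) (n div 2) / 2 \<in> \<int>" for n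
      unfolding Q_def by (rule fls_square_nth_even[OF int_F that])
    \<comment> \<open>For odd \<open>m\<close> the factor \<open>T\<close> supplies the missing
      power of 1/q.\<close>
    define g where "g = (if even m then P j * P j else [:0, 1:] * (P j * P j))"
    define G where "G = ipoly g T"
    have G_eq: "G = (if even m then Q else T * Q)"
      by (simp add: G_def g_def Q_def F_def)
    have int_G: "integral_fls G"
      unfolding G_def by (rule integral_fls_ipoly[OF int])
    have G0: "fls_nth G i = 0" if "i < - int m" for i
    proof (cases "even m")
      case True
      then show ?thesis using that by (simp add: G_eq Q0 j_def)
    next
      case False
      then show ?thesis
        using that fls_times_nth_eq_0[OF T0' Q0, of i] by (auto simp: G_eq j_def elim!: oddE)
    qed
    have G1: "fls_nth G (- int m) = 1"
    proof (cases "even m")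
      case True
      then have "- (2 * int j) = - int m" by (auto simp: j_def elim!: evenE)
      then show ?thesis using True Q1 by (simp add: G_eq)
    next
      case False
      then have "- int m = - 1 + (- (2 * int j))" by (auto simp: j_def elim!: oddE)
      then show ?thesis
        using False fls_times_nth_lowest[OF T0' Q0] T0(2) Q1 by (simp add: G_eq)
    qed
    \<comment> \<open>For even \<open>i\<close> the coefficient of \<open>T\<close> is even. For odd
      \<open>i\<close> the index n - i is odd, and odd coefficients of a square are even.\<close>
    have TQ_even: "fls_nth (T * Q) n / 2 \<in> \<int>" if n: "even n" for n
    proof -
      have "fls_nth T i * fls_nth Q (n - i) / 2 \<in> \<int>" for i
      proof (cases "even i")
        case True
        then show ?thesis
          using T_even int_Q by (intro half_Ints_mult(1)) (auto simp: integral_fls_def)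
      next
        case False
        then have "fls_nth Q (n - i) / 2 \<in> \<int>"
          using n by (intro Q_even) auto
        then show ?thesis
          using int by (intro half_Ints_mult(2)) (auto simp: integral_fls_def)
      qed
      then show ?thesis
        unfolding fls_times_nth(2) sum_divide_distrib by (intro Ints_sum) auto
    qed
    have pow: "k > 0" if "\<not> 2 ^ k dvd int l" for k l
      using that by (cases k) auto
    have G_even: "fls_nth G n / 2 \<in> \<int>" if k: "\<not> 2 ^ k dvd int m" "2 ^ k dvd n" for k n
    proof -
      obtain k' where k': "k = Suc k'"
        using pow[OF k(1)] by (cases k) auto
      then have n: "even n" using k(2) by (auto elim: dvd_trans[rotated])
      show ?thesis
      proof (cases "even m")
        case True
        \<comment> \<open>Halving both indices lowers \<open>k\<close> by one, so the induction
          hypothesis for \<open>j\<close> applies.\<close>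
        have "int m = 2 * int j" using True by (auto simp: j_def)
        then have "\<not> 2 ^ k' dvd int j" using k(1) by (simp add: k')
        moreover have "2 ^ k' dvd n div 2" using k(2) n by (auto simp: k')
        ultimately have "fls_nth (F j) (n div 2) / 2 \<in> \<int>"
          unfolding F_def by (rule P(2)[OF j])
        then show ?thesis using True Q_even by (simp add: G_eq)
      next
        case False
        then show ?thesis using TQ_even[OF n] by (simp add: G_eq)
      qed
    qed
    define c where "c l = (SOME x. of_int x = fls_nth G (- int l))" for l
    have c: "of_int (c l) = fls_nth G (- int l)" for l
    proof -
      have "\<exists>x. of_int x = fls_nth G (- int l)"
        using int_G by (metis Ints_cases integral_fls_def)
      then show ?thesis unfolding c_def by (rule someI_ex)
    qed
    \<comment> \<open>For even \<open>m\<close> the middle term of the square has index -l/2,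
      strictly between -j and 0 or equal to 0, where the coefficient of \<open>F j\<close> vanishes
      if l > 0 and also if l = 0, as then j > 0.\<close>
    have c_even: "of_int (c l) / 2 \<in> (\<int> :: complex set)" if l: "l < m" "even m \<or> even l" for l
    proof (cases "even m")
      case True
      have "fls_nth (F j) (- int l div 2) / 2 \<in> \<int>" if el: "even (- int l)"
      proof -
        obtain i where i: "l = 2 * i" using el by auto
        then have "- int l div 2 = - int i" "i < j"
          using l(1) True by (auto simp: j_def)
        then show ?thesis using F0[of "- int i" j] j by simp
      qed
      then have "fls_nth Q (- int l) / 2 \<in> \<int>"
        by (rule Q_even)
      then show ?thesis unfolding c using True by (simp add: G_eq)
    next
      case False
      then show ?thesis unfolding c using l TQ_even by (simp add: G_eq)
    qed
    define p where "p = g - (\<Sum>l<m. smult (c l) (P l))"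
    have nth_p: "fls_nth (ipoly p T) n = fls_nth G n - (\<Sum>l<m. of_int (c l) * fls_nth (F l) n)" for n
      by (simp add: p_def G_def F_def fls_nth_sum fls_of_int)
    have "principal m (ipoly p T)"
      unfolding principal_def
    proof (intro allI impI)
      fix n :: int assume n: "n \<le> 0"
      have "(\<Sum>l<m. of_int (c l) * fls_nth (F l) n) =
          (\<Sum>l<m. if l = nat (- n) then fls_nth G n else 0)"
        using n by (intro sum.cong) (auto simp: F0 c)
      also have "\<dots> = (if nat (- n) < m then fls_nth G n else 0)"
        by simp
      finally show "fls_nth (ipoly p T) n = (if n = - int m then 1 else 0)"
        unfolding nth_p using n G0[of n] G1 by auto
    qed
    moreover have "fls_nth (ipoly p T) n / 2 \<in> \<int>" if k: "\<not> 2 ^ k dvd int m" "2 ^ k dvd n" for k n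
    proof -
      have "of_int (c l) * fls_nth (F l) n / 2 \<in> \<int>" if l: "l < m" for l
      proof (cases "even m \<or> even l")
        case True
        then show ?thesis
          using c_even[OF l] int_F by (intro half_Ints_mult(1)) (auto simp: integral_fls_def)
      next
        case False
        \<comment> \<open>When \<open>m\<close> and \<open>l\<close> are both odd,
          \<open>c l\<close> may be odd; instead the coefficient of \<open>F l\<close> is even by
          the induction hypothesis.\<close>
        have "\<not> 2 ^ k dvd int l"
          using False pow[OF k(1)] by (metis dvd_power dvd_trans even_of_nat)
        then have "fls_nth (F l) n / 2 \<in> \<int>"
          unfolding F_def by (rule P(2)[OF l _ k(2)])
        then show ?thesis by (intro half_Ints_mult(2)) auto
      qed
      then show ?thesis
        unfolding nth_p diff_divide_distrib sum_divide_distrib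
        using G_even[OF k] by (intro Ints_diff Ints_sum) auto
    qed
    ultimately show ?thesis by blast
  qed
qed

subsection \<open>The basis functions\<close>

no_notation fps_nth (infixl \<open>$\<close> 75)

section \<open>Matrices and cusps\<close>

definition mat2 :: "int \<Rightarrow> int \<Rightarrow> int \<Rightarrow> int \<Rightarrow> int^2^2" where
  "mat2 a b c d = vector [vector [a, b], vector [c, d]]"

lemma moebius_mat2: "moebius (mat2 a b c d) = mob a b c d"
  by (simp add: moebius_def mob_def mat2_def fun_eq_iff)

lemma moebius_eq_mob: "moebius A = mob (A $ 1 $ 1) (A $ 1 $ 2) (A $ 2 $ 1) (A $ 2 $ 2)"
  by (simp add: moebius_def mob_def fun_eq_iff)

lemma SL2Z_iff: "A \<in> SL2Z \<longleftrightarrow> A $ 1 $ 1 * A $ 2 $ 2 - A $ 1 $ 2 * A $ 2 $ 1 = 1"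
  by (simp add: SL2Z_def det_2)

lemma mat2_in_SL2Z: "a * d - b * c = 1 \<Longrightarrow> mat2 a b c d \<in> SL2Z"
  by (simp add: SL2Z_iff mat2_def)

lemma mat2_in_Gamma0: "a * d - b * c = 1 \<Longrightarrow> int N dvd c \<Longrightarrow> mat2 a b c d \<in> Gamma0 N"
  by (simp add: Gamma0_def mat2_in_SL2Z) (simp add: mat2_def)

text \<open>The upper left entry of a matrix in \<open>Gamma0 N\<close> is coprime to
  \<open>N\<close>, so it can be cancelled from the cross-multiplied equation modulo
  \<open>N\<close>.\<close>

lemma is_cusp_infinity_iff:
  assumes "A \<in> SL2Z"
  shows "is_cusp_infinity N A \<longleftrightarrow> int N dvd A $ 2 $ 1"
proof
  assume "int N dvd A $ 2 $ 1"
  then have "A \<in> Gamma0 N"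
    using assms by (simp add: Gamma0_def)
  then show "is_cusp_infinity N A"
    unfolding is_cusp_infinity_def by (intro bexI[of _ A]) auto
next
  assume "is_cusp_infinity N A"
  then obtain B where B: "B \<in> Gamma0 N" "A $ 1 $ 1 * B $ 2 $ 1 = B $ 1 $ 1 * A $ 2 $ 1"
    unfolding is_cusp_infinity_def by blast
  then have N: "int N dvd B $ 2 $ 1" and det: "B $ 1 $ 1 * B $ 2 $ 2 - B $ 1 $ 2 * B $ 2 $ 1 = 1"
    by (auto simp: Gamma0_def SL2Z_iff)
  have "coprime (int N) (B $ 1 $ 1)"
  proof (rule coprimeI)
    fix x assume "x dvd int N" "x dvd B $ 1 $ 1"
    then have "x dvd B $ 1 $ 1 * B $ 2 $ 2 - B $ 1 $ 2 * B $ 2 $ 1"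
      using N by (intro dvd_diff dvd_mult dvd_mult2) (auto intro: dvd_trans)
    then show "is_unit x" using det by simp
  qed
  moreover have "int N dvd B $ 1 $ 1 * A $ 2 $ 1"
    using N B(2) by (metis dvd_mult)
  ultimately show "int N dvd A $ 2 $ 1"
    by (simp add: coprime_dvd_mult_right_iff)
qed

text \<open>Away from \<infinity>, holomorphy at a cusp is weakened to boundedness, the form in
  which the vanishing argument takes it.\<close>

lemma M0_sharpD:
  assumes "f \<in> M0_sharp N"
  shows "f \<in> extensional {z. Im z > 0}" "f holomorphic_on {z. Im z > 0}"
    "\<And>a b c d z. a * d - b * c = 1 \<Longrightarrow> int N dvd c \<Longrightarrow> Im z > 0 \<Longrightarrow> f (mob a b c d z) = f z"
    "\<And>a b c d. a * d - b * c = 1 \<Longrightarrow> \<not> int N dvd c \<Longrightarrow>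
      \<exists>B. eventually (\<lambda>z. norm (f (mob a b c d z)) \<le> B) Im_at_top"
proof -
  show "f \<in> extensional {z. Im z > 0}" "f holomorphic_on {z. Im z > 0}"
    using assms by (auto simp: M0_sharp_def weakly_holomorphic_modular_functions_def upper_half_plane_def)
  show "f (mob a b c d z) = f z" if "a * d - b * c = 1" "int N dvd c" "Im z > 0" for a b c d z
  proof -
    have "\<forall>A\<in>Gamma0 N. \<forall>z\<in>upper_half_plane. f (moebius A z) = f z"
      using assms by (simp add: M0_sharp_def weakly_holomorphic_modular_functions_def)
    then show ?thesis
      using mat2_in_Gamma0[OF that(1,2)] that(3) by (auto simp: moebius_mat2[symmetric] upper_half_plane_def)
  qed
  show "\<exists>B. eventually (\<lambda>z. norm (f (mob a b c d z)) \<le> B) Im_at_top"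
    if det: "a * d - b * c = 1" and c: "\<not> int N dvd c" for a b c d
  proof -
    have "\<not> is_cusp_infinity N (mat2 a b c d)"
      using c by (simp add: is_cusp_infinity_iff[OF mat2_in_SL2Z[OF det]]) (simp add: mat2_def)
    then have "holomorphic_at_cusp (mat2 a b c d) f"
      using assms mat2_in_SL2Z[OF det] by (simp add: M0_sharp_def)
    then obtain h F where h: "h > 0" "has_q_expansion h (\<lambda>z. f (mob a b c d z)) F"
      "\<And>n. n < 0 \<Longrightarrow> fls_nth F n = 0"
      unfolding holomorphic_at_cusp_def moebius_mat2 by blast
    have "norm (fls_nth F 0) < norm (fls_nth F 0) + 1"
      by linarith
    with tendsto_norm[OF has_q_expansion_tendsto[OF h]]
    have "eventually (\<lambda>z. norm (f (mob a b c d z)) < norm (fls_nth F 0) + 1) Im_at_top"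
      by (rule order_tendstoD(2))
    then show ?thesis
      by (intro exI[of _ "norm (fls_nth F 0) + 1"]) (auto elim: eventually_mono)
  qed
qed

text \<open>The difference has neither polar part nor constant term at \<infinity>, so it tends to 0
  there, and it is bounded at the other cusps.\<close>

lemma M0_sharp_unique:
  assumes N: "N > 0" and f: "f \<in> M0_sharp N" and g: "g \<in> M0_sharp N"
    and F: "has_q_expansion 1 f F" and G: "has_q_expansion 1 g G"
    and eq: "\<And>n. n \<le> 0 \<Longrightarrow> fls_nth F n = fls_nth G n"
  shows "f = g"
proof -
  define \<phi> where "\<phi> z = f z - g z" for z
  note fD = M0_sharpD[OF f] and gD = M0_sharpD[OF g]
  have exp: "has_q_expansion 1 \<phi> (F - G)"
    using F G has_laurent_expansion_diff unfolding has_q_expansion_def \<phi>_def by fastforce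
  have "(\<phi> \<longlongrightarrow> fls_nth (F - G) 0) Im_at_top"
    by (rule has_q_expansion_tendsto[OF _ exp]) (auto simp: eq)
  then have lim: "(\<phi> \<longlongrightarrow> 0) Im_at_top"
    by (simp add: eq)
  have inv: "\<phi> (mob a b c d z) = \<phi> z" if "a * d - b * c = 1" "int N dvd c" "Im z > 0" for a b c d z
    using fD(3)[OF that] gD(3)[OF that] by (simp add: \<phi>_def)
  have "\<phi> z = 0" if "Im z > 0" for z
  proof (rule Gamma0_vanishing[OF N _ inv _ lim that])
    show "\<phi> holomorphic_on {z. Im z > 0}"
      unfolding \<phi>_def[abs_def] by (intro holomorphic_intros fD gD)
    fix a b c d :: int assume det: "a * d - b * c = 1"
    show "\<exists>B. eventually (\<lambda>z. norm (\<phi> (mob a b c d z)) \<le> B) Im_at_top"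
    proof (cases "int N dvd c")
      case True
      \<comment> \<open>At a cusp equivalent to \<infinity> the translate is \<open>\<phi>\<close>
        itself.\<close>
      have "eventually (\<lambda>z. norm (\<phi> z) < 1) Im_at_top"
        using tendstoD[OF lim, of 1] by simp
      moreover have "eventually (\<lambda>z. Im z > 0) Im_at_top"
        unfolding eventually_Im_at_top by (auto intro!: exI[of _ 0])
      ultimately have "eventually (\<lambda>z. norm (\<phi> (mob a b c d z)) \<le> 1) Im_at_top"
        by eventually_elim (simp add: inv[OF det True])
      then show ?thesis ..
    next
      case False
      obtain B1 B2 where "eventually (\<lambda>z. norm (f (mob a b c d z)) \<le> B1) Im_at_top"
        "eventually (\<lambda>z. norm (g (mob a b c d z)) \<le> B2) Im_at_top"
        using fD(4)[OF det False] gD(4)[OF det False] by blast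
      then have "eventually (\<lambda>z. norm (\<phi> (mob a b c d z)) \<le> B1 + B2) Im_at_top"
        by eventually_elim (auto simp: \<phi>_def intro: order_trans[OF norm_triangle_ineq4] add_mono)
      then show ?thesis ..
    qed
  qed auto
  then show ?thesis
    using extensionalityI[OF fD(1) gD(1)] by (simp add: \<phi>_def)
qed

section \<open>Polynomials in the Hauptmodul as basis functions\<close>

lemma holomorphic_ipoly:
  "f holomorphic_on A \<Longrightarrow> (\<lambda>z. ipoly p (f z)) holomorphic_on A"
  by (induction p) (auto intro!: holomorphic_intros)

lemma has_q_expansion_cong:
  assumes "\<And>z. Im z > 0 \<Longrightarrow> f z = g z"
  shows "has_q_expansion h f F \<longleftrightarrow> has_q_expansion h g F"
  using assms by (simp add: has_q_expansion_def upper_half_plane_def)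

lemma ipoly_hauptmodul_in_M0_sharp:
  "restrict (\<lambda>z. ipoly p (hauptmodul z)) upper_half_plane \<in> M0_sharp 10"
proof -
  define f where "f = restrict (\<lambda>z. ipoly p (hauptmodul z)) upper_half_plane"
  have f: "f z = ipoly p (hauptmodul z)" if "Im z > 0" for z
    using that by (simp add: f_def upper_half_plane_def)
  have "(\<lambda>z. ipoly p (hauptmodul z)) holomorphic_on {z. Im z > 0}"
    by (intro holomorphic_ipoly holomorphic_hauptmodul)
  then have hol: "f holomorphic_on {z. Im z > 0}"
    by (rule holomorphic_transform) (simp add: f)
  have inv: "f (moebius A z) = f z" if "A \<in> Gamma0 10" "z \<in> upper_half_plane" for A z
  proof -
    have det: "A $ 1 $ 1 * A $ 2 $ 2 - A $ 1 $ 2 * A $ 2 $ 1 = 1" and "10 dvd A $ 2 $ 1" "Im z > 0"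
      using that by (auto simp: Gamma0_def SL2Z_iff upper_half_plane_def)
    then show ?thesis
      unfolding moebius_eq_mob by (simp add: f Im_mob_pos hauptmodul_mob)
  qed
  have cusp: "\<exists>F. has_q_expansion 120 (\<lambda>z. f (moebius A z)) F \<and>
      (\<not> is_cusp_infinity 10 A \<longrightarrow> (\<forall>n<0. fls_nth F n = 0))" if A: "A \<in> SL2Z" for A
  proof -
    have det: "A $ 1 $ 1 * A $ 2 $ 2 - A $ 1 $ 2 * A $ 2 $ 1 = 1"
      using A by (simp add: SL2Z_iff)
    obtain F where F: "has_q_expansion 120 (\<lambda>z. hauptmodul (moebius A z)) F"
      "\<not> 10 dvd A $ 2 $ 1 \<Longrightarrow> \<forall>n<0. fls_nth F n = 0"
      using hauptmodul_at_cusp[OF det] unfolding moebius_eq_mob by blast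
    have "has_q_expansion 120 (\<lambda>z. ipoly p (hauptmodul (moebius A z))) (ipoly p F)"
      by (rule has_q_expansion_ipoly[OF F(1)])
    then have "has_q_expansion 120 (\<lambda>z. f (moebius A z)) (ipoly p F)"
      by (subst has_q_expansion_cong[where g = "\<lambda>z. ipoly p (hauptmodul (moebius A z))"])
        (auto simp: f moebius_eq_mob Im_mob_pos[OF _ det])
    moreover have "\<forall>n<0. fls_nth (ipoly p F) n = 0" if "\<not> is_cusp_infinity 10 A"
    proof -
      have "\<not> 10 dvd A $ 2 $ 1"
        using that is_cusp_infinity_iff[OF A, of 10] by simp
      from F(2)[OF this] show ?thesis
        using ipoly_nonneg[of F _ p] by auto
    qed
    ultimately show ?thesis by blast
  qed
  have "f \<in> extensional upper_half_plane"
    by (simp add: f_def)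
  moreover have "(120::nat) > 0" by simp
  ultimately have "f \<in> M0_sharp 10"
    unfolding M0_sharp_def weakly_holomorphic_modular_functions_def meromorphic_at_cusp_def
      holomorphic_at_cusp_def
    using hol inv cusp unfolding upper_half_plane_def[symmetric] by blast
  then show ?thesis by (simp add: f_def)
qed

text \<open>\<open>f0\<close> and \<open>q_expansion\<close> are definite descriptions. The
  polynomial in the Hauptmodul is a witness, and the two uniqueness results identify it with the
  described objects.\<close>

lemma a0_eq:
  assumes T: "has_q_expansion 1 hauptmodul T" and p: "principal m (ipoly p T)"
  shows "a0 10 m n = fls_nth (ipoly p T) n"
proof -
  define f where "f = restrict (\<lambda>z. ipoly p (hauptmodul z)) upper_half_plane"
  have f: "f \<in> M0_sharp 10"
    unfolding f_def by (rule ipoly_hauptmodul_in_M0_sharp)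
  have "has_q_expansion 1 f (ipoly p T) \<longleftrightarrow>
      has_q_expansion 1 (\<lambda>z. ipoly p (hauptmodul z)) (ipoly p T)"
    by (rule has_q_expansion_cong) (simp add: f_def upper_half_plane_def)
  then have exp: "has_q_expansion 1 f (ipoly p T)"
    using has_q_expansion_ipoly[OF T] by simp
  have "f0 10 m = f"
    unfolding f0_def
  proof (rule the_equality)
    show "f \<in> M0_sharp 10 \<and> (\<exists>F. has_q_expansion 1 f F \<and>
        (\<forall>n\<le>0. fls_nth F n = (if n = - int m then 1 else 0)))"
      using f exp p by (auto simp: principal_def)
    fix g assume "g \<in> M0_sharp 10 \<and> (\<exists>F. has_q_expansion 1 g F \<and>
        (\<forall>n\<le>0. fls_nth F n = (if n = - int m then 1 else 0)))"
    then obtain G where G: "g \<in> M0_sharp 10" "has_q_expansion 1 g G"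
      "\<And>n. n \<le> 0 \<Longrightarrow> fls_nth G n = (if n = - int m then 1 else 0)"
      by blast
    show "g = f"
      by (rule M0_sharp_unique[OF _ G(1) f G(2) exp]) (use G(3) p in \<open>auto simp: principal_def\<close>)
  qed
  moreover have "q_expansion f = ipoly p T"
    unfolding q_expansion_def using exp has_q_expansion_unique[of 1 f] by (intro the_equality) auto
  ultimately show ?thesis
    by (simp add: a0_def)
qed

lemma a0_properties:
  shows a0_integral: "a0 10 m n \<in> \<int>"
    and a0_nonpos: "n \<le> 0 \<Longrightarrow> a0 10 m n = (if n = - int m then 1 else 0)"
    and a0_symmetry: "m > 0 \<Longrightarrow> l > 0 \<Longrightarrow> of_nat m * a0 10 l (int m) = of_nat l * a0 10 m (int l)"
    and a0_even: "\<not> 2 ^ k dvd int m \<Longrightarrow> 2 ^ k dvd n \<Longrightarrow> a0 10 m n / 2 \<in> \<int>"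
proof -
  obtain X where T: "has_q_expansion 1 hauptmodul (fls_X_inv * fps_to_fls (X ^ 2))"
    and X: "integral_fps X" "fps_nth X 0 = 1"
    by (rule hauptmodul_q_expansion)
  define T where "T = fls_X_inv * fps_to_fls (X ^ 2)"
  have nth_T: "fls_nth T n = fls_nth (fps_to_fls X * fps_to_fls X) (n + 1)" for n
    by (simp add: T_def fls_X_inv_times_conv_shift power2_eq_square fls_times_fps_to_fls)
  have int_X: "integral_fls (fps_to_fls X)"
    using X(1) by (auto simp: integral_fls_def integral_fps_def)
  have int_T: "integral_fls T"
    using integral_fls_mult[OF int_X int_X] by (simp add: integral_fls_def nth_T)
  have T0: "fls_nth T n = 0" if "n < - 1" for n
    using that by (simp add: nth_T fls_times_fps_to_fls[symmetric])
  have T1: "fls_nth T (- 1) = 1"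
    by (simp add: nth_T fls_times_fps_to_fls[symmetric] X(2))
  \<comment> \<open>\<open>T\<close> is a square shifted by one, so its even coefficients are the
    odd ones of a square.\<close>
  have T_even: "fls_nth T n / 2 \<in> \<int>" if "even n" for n
    unfolding nth_T by (rule fls_square_nth_even[OF int_X]) (use that in auto)
  have "\<exists>p. principal m (ipoly p T) \<and>
    (\<forall>k n. \<not> 2 ^ k dvd int m \<longrightarrow> 2 ^ k dvd n \<longrightarrow> fls_nth (ipoly p T) n / 2 \<in> \<int>)" for m
    by (rule faber_polynomial_exists[OF int_T T0 T1 T_even])
  then obtain P where P: "\<And>m. principal m (ipoly (P m) T)"
    "\<And>m k n. \<not> 2 ^ k dvd int m \<Longrightarrow> 2 ^ k dvd n \<Longrightarrow> fls_nth (ipoly (P m) T) n / 2 \<in> \<int>"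
    by metis
  have a0: "a0 10 m n = fls_nth (ipoly (P m) T) n" for m n
    by (rule a0_eq[OF T[folded T_def] P(1)])
  show "a0 10 m n \<in> \<int>"
    using integral_fls_ipoly[OF int_T] by (simp add: a0 integral_fls_def)
  show "n \<le> 0 \<Longrightarrow> a0 10 m n = (if n = - int m then 1 else 0)"
    using P(1)[of m] by (simp add: a0 principal_def)
  show "m > 0 \<Longrightarrow> l > 0 \<Longrightarrow> of_nat m * a0 10 l (int m) = of_nat l * a0 10 m (int l)"
    unfolding a0 using grunsky_symmetry[OF P(1) refl P(1) refl] by blast
  show "\<not> 2 ^ k dvd int m \<Longrightarrow> 2 ^ k dvd n \<Longrightarrow> a0 10 m n / 2 \<in> \<int>"
    unfolding a0 by (rule P(2))
qed

subsection \<open>The congruences\<close>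

lemma cong_zeroI: "x = of_int k \<Longrightarrow> M dvd k \<Longrightarrow> cong_zero x M"
  unfolding cong_zero_def cong_0_iff by blast

lemma cong_zero_2_iff: "cong_zero x 2 \<longleftrightarrow> x / 2 \<in> \<int>"
proof
  assume "x / 2 \<in> \<int>"
  then obtain k where "x / 2 = of_int k" by (auto elim: Ints_cases)
  then have "x = of_int (2 * k)" by simp
  then show "cong_zero x 2" by (rule cong_zeroI) simp
next
  assume "cong_zero x 2"
  then show "x / 2 \<in> \<int>"
    by (auto simp: cong_zero_def cong_0_iff)
qed

lemma prime_power_dvd_iff:
  fixes p s :: int
  assumes "\<not> is_unit p" "p \<noteq> 0" "coprime s p"
  shows "p ^ k dvd p ^ b * s \<longleftrightarrow> k \<le> b"
proof
  assume dvd: "p ^ k dvd p ^ b * s"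
  have "coprime (p ^ k) s"
    using assms(3) by (simp add: coprime_commute)
  with dvd have "p ^ k dvd p ^ b"
    by (simp add: coprime_dvd_mult_left_iff)
  then show "k \<le> b"
    using assms(1,2) by (simp add: dvd_power_iff)
qed (intro dvd_mult2 le_imp_power_dvd)

text \<open>Symmetry exchanges the two indices and yields p^(a-b); \<open>e\<close> is a divisor
  already known for the exchanged coefficient, 2 for p = 2 and 1 for p = 5.\<close>

lemma a0_cong_zero:
  fixes p r s :: int
  assumes p: "p > 1" and r: "coprime r p" "r > 0" and s: "coprime s p" and ab: "a > b"
    and e: "s > 0 \<Longrightarrow> cong_zero (a0 10 (nat (p ^ b * s)) (p ^ a * r)) e"
    and es: "coprime e s"
  shows "cong_zero (a0 10 (nat (p ^ a * r)) (p ^ b * s)) (p ^ (a - b) * e)"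
proof -
  have unit: "\<not> is_unit p" using p by auto
  define m where "m = nat (p ^ a * r)"
  have m: "int m = p ^ a * r" "m > 0"
    using p r by (simp_all add: m_def)
  show ?thesis
  proof (cases "s > 0")
    case False
    \<comment> \<open>For negative \<open>s\<close> the coefficient is 0 unless it is the leading
      one, which the different powers of \<open>p\<close> exclude.\<close>
    have ne: "p ^ b * s \<noteq> - int m"
    proof
      assume "p ^ b * s = - int m"
      then have "p ^ a dvd p ^ b * s"
        by (simp add: m)
      then show False
        using prime_power_dvd_iff[OF unit _ s, of a b] p ab by simp
    qed
    have "p ^ b * s \<le> 0"
      using False p by (simp add: mult_le_0_iff)
    then have "a0 10 m (p ^ b * s) = 0"
      using ne by (simp add: a0_nonpos)
    then show ?thesis
      by (intro cong_zeroI[of _ 0]) (simp_all add: m_def)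
  next
    case True
    define l where "l = nat (p ^ b * s)"
    have l: "int l = p ^ b * s" "l > 0"
      using p True by (simp_all add: l_def)
    obtain A where A: "a0 10 m (int l) = of_int A"
      using a0_integral[of m "int l"] by (auto elim: Ints_cases)
    obtain B where B: "a0 10 l (int m) = of_int B" "e dvd B"
      using e[OF True] by (auto simp: cong_zero_def cong_0_iff l_def m(1))
    have "of_int (int m * B) = (of_int (int l * A) :: complex)"
      using a0_symmetry[OF m(2) l(2)] A B by simp
    then have "int m * B = int l * A"
      by (simp only: of_int_eq_iff)
    moreover have "p ^ a = p ^ b * p ^ (a - b)"
      using ab by (simp add: power_add[symmetric])
    ultimately have "p ^ b * (p ^ (a - b) * (r * B)) = p ^ b * (s * A)"
      by (simp add: m(1) l(1) mult_ac)
    then have eq: "p ^ (a - b) * (r * B) = s * A"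
      using p by simp
    have "p ^ (a - b) * e dvd s * A"
      unfolding eq[symmetric] using B(2) by (intro mult_dvd_mono) auto
    moreover have "coprime (p ^ (a - b) * e) s"
      using s es by (simp add: coprime_commute)
    ultimately have "p ^ (a - b) * e dvd A"
      by (simp add: coprime_dvd_mult_right_iff)
    then show ?thesis
      using A by (intro cong_zeroI[of _ A]) (simp_all add: m_def l)
  qed
qed

theorem theorem1p5:
  fixes a b :: nat
  shows "(\<forall>r s :: int. coprime r 2 \<and> coprime s 2 \<and> r > 0 \<longrightarrow>
            (a > b \<longrightarrow> cong_zero (a0 10 (nat (2 ^ a * r)) (2 ^ b * s)) (2 ^ (a - b + 1))) \<and>
            (b > a \<longrightarrow> cong_zero (a0 10 (nat (2 ^ a * r)) (2 ^ b * s)) 2)) \<and>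
         (\<forall>r s :: int. coprime r 5 \<and> coprime s 5 \<and> r > 0 \<longrightarrow>
            (a > b \<longrightarrow> cong_zero (a0 10 (nat (5 ^ a * r)) (5 ^ b * s)) (5 ^ (a - b))))"
proof -
  have even: "cong_zero (a0 10 (nat (2 ^ a * r)) (2 ^ b * s)) 2"
    if r: "coprime r 2" "r > 0" and "a < b" for r s :: int and a b :: nat
    unfolding cong_zero_2_iff
  \<comment> \<open>2^b divides the exponent but not 2^a r, since \<open>r\<close> is odd and a <
    b.\<close>
  proof (rule a0_even[where k = b])
    show "\<not> 2 ^ b dvd int (nat (2 ^ a * r))"
      using prime_power_dvd_iff[of 2 r b a] r \<open>a < b\<close> by simp
  qed simp
  \<comment> \<open>The extra factor 2 comes from \<open>even\<close> with the indices exchanged, as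
    b < a.\<close>
  have "cong_zero (a0 10 (nat (2 ^ a * r)) (2 ^ b * s)) (2 ^ (a - b + 1))"
    if "coprime r 2" "coprime s 2" "r > 0" "b < a" for r s :: int
    using a0_cong_zero[of 2 r s b a 2] even[of s b a r] that by (simp add: coprime_commute mult.commute)
  moreover have "cong_zero (a0 10 (nat (5 ^ a * r)) (5 ^ b * s)) (5 ^ (a - b))"
    if "coprime r 5" "coprime s 5" "r > 0" "b < a" for r s :: int
  proof -
    \<comment> \<open>The modulus 1 records integrality alone.\<close>
    have "cong_zero (a0 10 (nat (5 ^ b * s)) (5 ^ a * r)) 1" if "s > 0"
      using a0_integral[of "nat (5 ^ b * s)" "5 ^ a * r"]
      by (auto elim!: Ints_cases intro: cong_zeroI)
    then show ?thesis
      using a0_cong_zero[of 5 r s b a 1] that by simp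
  qed
  ultimately show ?thesis
    using even by blast
qed

end
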